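(* There exists a group homomorphism $\theta : F_\infty \to \mathrm{Aut}(F_4 \times F_2)$ such that the semidirect product $G = (F_4 \times F_2) \rtimes_\theta F_\infty$ admits an infinite minimal sofic shift; that is, there are a finite set $B$ and a sofic shift $Y \subseteq B^G$ which is infinite and minimal.
   Context: $F_k$ denotes the free group on $k$ free generators, and $F_\infty$ the free group on countably infinitely many free generators. For a countable group $G$ and a finite set $A$ (alphabet), the full shift is $A^G$ with the product topology and the continuous action $(gx)_h = x_{g^{-1}h}$. A subshift is a closed $G$-invariant subset of a full shift. A subshift of finite type (SFT) is a subshift of the form $\{x \in A^G : \forall g \in G,\ gx \notin C\}$ with $C \subseteq A^G$ clopen. A sofic shift is a subshift $Y \subseteq B^G$ (with $B$ finite) which is the image of some SFT $X \subseteq A^G$ ($A$ finite) under a continuous shift-commuting surjection $X \to Y$. A subshift is minimal if it is nonempty and has no nonempty proper closed $G$-invariant subset. *)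

theory Defs
  imports "HOL-Analysis.Analysis" "HOL-Algebra.Bij"
begin

section \<open>Free groups\<close>

text \<open>
  A letter \<open>(s, True)\<close> stands for the generator \<open>s\<close> and \<open>(s, False)\<close> for its inverse.
  The free group on \<open>S\<close> consists of the reduced words over \<open>S\<close>, multiplied by
  concatenation followed by free reduction.
\<close>

type_synonym 'a word = "('a \<times> bool) list"

definition inv_letter :: "'a \<times> bool \<Rightarrow> 'a \<times> bool" where
  "inv_letter l = (fst l, \<not> snd l)"

definition reduced_word :: "'a word \<Rightarrow> bool" where
  "reduced_word w \<longleftrightarrow> successively (\<lambda>l m. m \<noteq> inv_letter l) w"

fun lmult :: "'a \<times> bool \<Rightarrow> 'a word \<Rightarrow> 'a word" where
  "lmult l [] = [l]"
| "lmult l (m # w) = (if m = inv_letter l then w else l # m # w)"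

definition free_group :: "'a set \<Rightarrow> 'a word monoid" where
  "free_group S =
     \<lparr>carrier = {w. reduced_word w \<and> fst ` set w \<subseteq> S}, mult = (\<lambda>u v. foldr lmult u v), one = []\<rparr>"

lemma inv_letter_inv_letter [simp]: "inv_letter (inv_letter l) = l"
  by (simp add: inv_letter_def)

lemma inv_letter_neq [simp]: "inv_letter l \<noteq> l" "l \<noteq> inv_letter l"
  by (auto simp: inv_letter_def prod_eq_iff)

lemma fst_inv_letter [simp]: "fst (inv_letter l) = fst l"
  by (simp add: inv_letter_def)

lemma reduced_Nil [simp]: "reduced_word []"
  by (simp add: reduced_word_def)

lemma reduced_Cons: "reduced_word (l # w) \<longleftrightarrow> w = [] \<or> hd w \<noteq> inv_letter l \<and> reduced_word w"
  by (auto simp: reduced_word_def successively_Cons)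

lemma reduced_lmult: "reduced_word w \<Longrightarrow> reduced_word (lmult l w)"
  by (cases w) (auto simp: reduced_Cons)

lemma lmult_reduced: "reduced_word (l # w) \<Longrightarrow> lmult l w = l # w"
  by (cases w) (auto simp: reduced_Cons)

lemma lmult_cancel: "reduced_word w \<Longrightarrow> lmult (inv_letter l) (lmult l w) = w"
  by (cases w) (auto simp: reduced_Cons lmult_reduced)

lemma reduced_foldr_lmult: "reduced_word v \<Longrightarrow> reduced_word (foldr lmult u v)"
  by (induction u) (auto intro: reduced_lmult)

lemma letters_lmult: "fst ` set (lmult l w) \<subseteq> insert (fst l) (fst ` set w)"
  by (cases w) auto

lemma letters_foldr_lmult: "fst ` set (foldr lmult u v) \<subseteq> fst ` set u \<union> fst ` set v"
proof (induction u)
  case (Cons l u)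
  have "fst ` set (lmult l (foldr lmult u v)) \<subseteq> insert (fst l) (fst ` set u \<union> fst ` set v)"
    by (rule order_trans[OF letters_lmult insert_mono[OF Cons.IH]])
  then show ?case by simp
qed simp

lemma foldr_lmult_lmult:
  assumes "reduced_word w"
  shows "foldr lmult (lmult l u) w = lmult l (foldr lmult u w)"
proof (cases u)
  case (Cons m v)
  then show ?thesis
    using lmult_cancel[OF reduced_foldr_lmult[OF assms], of "inv_letter l" v] by auto
qed simp

lemma foldr_lmult_assoc:
  "reduced_word w \<Longrightarrow> foldr lmult (foldr lmult u v) w = foldr lmult u (foldr lmult v w)"
  by (induction u) (auto simp: foldr_lmult_lmult)

lemma foldr_lmult_Nil: "reduced_word u \<Longrightarrow> foldr lmult u [] = u"
proof (induction u)
  case (Cons l u)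
  then have "reduced_word u" by (auto simp: reduced_Cons)
  with Cons show ?case by (simp add: lmult_reduced)
qed simp

lemma foldr_lmult_inv:
  "reduced_word v \<Longrightarrow> foldr lmult (rev (map inv_letter u)) (foldr lmult u v) = v"
  by (induction u) (auto simp: lmult_cancel reduced_foldr_lmult)

lemma reduced_inv: "reduced_word u \<Longrightarrow> reduced_word (rev (map inv_letter u))"
  unfolding reduced_word_def successively_rev successively_map
  by (erule successively_mono) (auto simp: inv_letter_def prod_eq_iff)

lemma group_free_group: "Group.group (free_group S)"
proof (rule groupI)
  fix u assume u: "u \<in> carrier (free_group S)"
  have "rev (map inv_letter u) \<in> carrier (free_group S)"
    using u by (auto simp: free_group_def reduced_inv)
  moreover have "rev (map inv_letter u) \<otimes>\<^bsub>free_group S\<^esub> u = \<one>\<^bsub>free_group S\<^esub>"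
    using u foldr_lmult_inv[of "[]" u] by (simp add: free_group_def foldr_lmult_Nil)
  ultimately show "\<exists>v\<in>carrier (free_group S). v \<otimes>\<^bsub>free_group S\<^esub> u = \<one>\<^bsub>free_group S\<^esub>"
    by blast
next
  fix u v assume "u \<in> carrier (free_group S)" "v \<in> carrier (free_group S)"
  then show "u \<otimes>\<^bsub>free_group S\<^esub> v \<in> carrier (free_group S)"
    using order_trans[OF letters_foldr_lmult[of u v], of S]
    by (simp add: free_group_def reduced_foldr_lmult)
qed (auto simp: free_group_def foldr_lmult_assoc)

lemma free_group_universal:
  assumes G: "Group.group G" and f: "f \<in> S \<rightarrow> carrier G"
  obtains h where "h \<in> hom (free_group S) G" "\<And>s. s \<in> S \<Longrightarrow> h [(s, True)] = f s"
    "\<And>k w. \<lbrakk>k \<in> hom (free_group S) G; \<And>s. s \<in> S \<Longrightarrow> k [(s, True)] = f s;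
             w \<in> carrier (free_group S)\<rbrakk> \<Longrightarrow> k w = h w"
proof -
  interpret G: Group.group G by (rule G)
  interpret F: Group.group "free_group S" by (rule group_free_group)
  define e where "e = (\<lambda>l. if snd l then f (fst l) else inv\<^bsub>G\<^esub> f (fst l))"
  define h where "h = (\<lambda>w. foldr (\<lambda>l g. e l \<otimes>\<^bsub>G\<^esub> g) w \<one>\<^bsub>G\<^esub>)"
  have h_simps [simp]: "h [] = \<one>\<^bsub>G\<^esub>" "\<And>l w. h (l # w) = e l \<otimes>\<^bsub>G\<^esub> h w"
    by (simp_all add: h_def)
  have e: "e l \<in> carrier G" if "fst l \<in> S" for l
    using f that by (auto simp: e_def)
  have e_inv: "e (inv_letter l) = inv\<^bsub>G\<^esub> e l" if "fst l \<in> S" for l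
    using funcset_mem[OF f that] by (auto simp: e_def inv_letter_def)
  have h: "h w \<in> carrier G" if "fst ` set w \<subseteq> S" for w
    using that by (induction w) (auto simp: e)
  have h_lmult: "h (lmult l w) = e l \<otimes>\<^bsub>G\<^esub> h w" if "fst l \<in> S" "fst ` set w \<subseteq> S" for l w
    using that by (cases w) (auto simp: e h e_inv simp flip: G.m_assoc)
  have h_mult: "h (foldr lmult u v) = h u \<otimes>\<^bsub>G\<^esub> h v"
    if "fst ` set u \<subseteq> S" "fst ` set v \<subseteq> S" for u v
    using that(1)
  proof (induction u)
    case (Cons l u)
    then have "fst ` set (foldr lmult u v) \<subseteq> S"
      using order_trans[OF letters_foldr_lmult[of u v], of S] that(2) by simp
    with Cons that(2) show ?case by (simp add: h_lmult e h G.m_assoc)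
  qed (use that(2) in \<open>simp add: h\<close>)
  have h_hom: "h \<in> hom (free_group S) G"
    by (rule homI) (auto simp: free_group_def h h_mult)
  have h_gen: "h [(s, True)] = f s" if "s \<in> S" for s
    using funcset_mem[OF f that] by (simp add: e_def)
  have "k w = h w"
    if k: "k \<in> hom (free_group S) G" and kf: "\<And>s. s \<in> S \<Longrightarrow> k [(s, True)] = f s"
      and w: "w \<in> carrier (free_group S)" for k w
  proof -
    interpret k: group_hom "free_group S" G k
      by (unfold_locales) (rule k)
    have single: "[l] \<in> carrier (free_group S)" if "fst l \<in> S" for l
      using that by (simp add: free_group_def reduced_Cons)
    have k_single: "k [l] = e l" if l: "fst l \<in> S" for l
    proof (cases "snd l")
      case True
      then show ?thesis using kf[OF l] by (cases l) (simp add: e_def)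
    next
      case False
      have "inv\<^bsub>free_group S\<^esub> [(fst l, True)] = [l]"
        using False single[OF l] single[of "(fst l, True)"] l
        by (intro F.inv_equality) (auto simp: free_group_def inv_letter_def prod_eq_iff)
      then show ?thesis
        using k.hom_inv[of "[(fst l, True)]"] single[of "(fst l, True)"] kf[OF l] False l
        by (simp add: e_def)
    qed
    show ?thesis using w
    proof (induction w)
      case Nil
      have "\<one>\<^bsub>free_group S\<^esub> = []" by (simp add: free_group_def)
      then show ?case using k.hom_one by simp
    next
      case (Cons l w)
      then have red: "reduced_word (l # w)" and l: "fst l \<in> S" and w: "w \<in> carrier (free_group S)"
        by (auto simp: free_group_def reduced_Cons)
      have "k (l # w) = k ([l] \<otimes>\<^bsub>free_group S\<^esub> w)"
        using red by (simp add: free_group_def lmult_reduced)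
      also have "\<dots> = e l \<otimes>\<^bsub>G\<^esub> h w"
        using k.hom_mult[OF single[OF l] w] Cons.IH[OF w] k_single[OF l] by simp
      finally show ?case by simp
    qed
  qed
  with h_hom h_gen that show thesis by blast
qed


section \<open>Semidirect products\<close>

definition semidirect_product ::
    "('n, 'c) monoid_scheme \<Rightarrow> ('h, 'd) monoid_scheme \<Rightarrow> ('h \<Rightarrow> 'n \<Rightarrow> 'n) \<Rightarrow> ('n \<times> 'h) monoid" where
  "semidirect_product N H \<theta> =
     \<lparr>carrier = carrier N \<times> carrier H,
      mult = (\<lambda>(n, h) (n', h'). (n \<otimes>\<^bsub>N\<^esub> \<theta> h n', h \<otimes>\<^bsub>H\<^esub> h')),
      one = (\<one>\<^bsub>N\<^esub>, \<one>\<^bsub>H\<^esub>)\<rparr>"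

lemma group_semidirect_product:
  assumes "Group.group N" and "Group.group H" and \<theta>: "\<theta> \<in> hom H (AutoGroup N)"
  shows "Group.group (semidirect_product N H \<theta>)"
proof -
  interpret N: Group.group N by (rule assms)
  interpret H: Group.group H by (rule assms)
  interpret A: Group.group "AutoGroup N" by (rule N.AutoGroup)
  interpret \<theta>: group_hom H "AutoGroup N" \<theta> by unfold_locales (rule \<theta>)
  have \<theta>_auto: "\<theta> h \<in> auto N" if "h \<in> carrier H" for h
    using \<theta>.hom_closed[OF that] by (simp add: AutoGroup_def)
  have \<theta>_hom: "\<theta> h \<in> hom N N" if "h \<in> carrier H" for h
    using \<theta>_auto[OF that] by (simp add: auto_def)
  note \<theta>_closed = hom_in_carrier[OF \<theta>_hom] and \<theta>_mult = hom_mult[OF \<theta>_hom]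
  have \<theta>_comp: "\<theta> (h \<otimes>\<^bsub>H\<^esub> h') n = \<theta> h (\<theta> h' n)"
    if "h \<in> carrier H" "h' \<in> carrier H" "n \<in> carrier N" for h h' n
    using \<theta>.hom_mult[OF that(1,2)] \<theta>_auto[OF that(1)] \<theta>_auto[OF that(2)] that(3)
    by (simp add: AutoGroup_def BijGroup_def auto_def compose_def)
  have \<theta>_one: "\<theta> \<one>\<^bsub>H\<^esub> n = n" if "n \<in> carrier N" for n
    using \<theta>.hom_one that by (simp add: AutoGroup_def BijGroup_def)
  show ?thesis
  proof (rule groupI)
    fix x assume "x \<in> carrier (semidirect_product N H \<theta>)"
    then obtain n h where x: "x = (n, h)" "n \<in> carrier N" "h \<in> carrier H"
      by (auto simp: semidirect_product_def)
    have closed: "\<theta> (inv\<^bsub>H\<^esub> h) (inv\<^bsub>N\<^esub> n) \<in> carrier N"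
      using x by (intro \<theta>_closed) auto
    have "\<theta> (inv\<^bsub>H\<^esub> h) (inv\<^bsub>N\<^esub> n) \<otimes>\<^bsub>N\<^esub> \<theta> (inv\<^bsub>H\<^esub> h) n = \<theta> (inv\<^bsub>H\<^esub> h) \<one>\<^bsub>N\<^esub>"
      using x \<theta>_mult[of "inv\<^bsub>H\<^esub> h" "inv\<^bsub>N\<^esub> n" n] by simp
    also have "\<dots> = \<one>\<^bsub>N\<^esub>"
      using x by (intro hom_one[OF \<theta>_hom]) (auto intro: assms)
    finally show "\<exists>y\<in>carrier (semidirect_product N H \<theta>).
        y \<otimes>\<^bsub>semidirect_product N H \<theta>\<^esub> x = \<one>\<^bsub>semidirect_product N H \<theta>\<^esub>"
      using x by (intro bexI[of _ "(\<theta> (inv\<^bsub>H\<^esub> h) (inv\<^bsub>N\<^esub> n), inv\<^bsub>H\<^esub> h)"])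
        (use closed in \<open>auto simp: semidirect_product_def\<close>)
  qed (auto simp: semidirect_product_def \<theta>_closed \<theta>_mult \<theta>_comp \<theta>_one N.m_assoc H.m_assoc
      simp del: \<theta>.hom_mult \<theta>.hom_one)
qed


section \<open>Symbolic dynamics over a group\<close>

text \<open>
  Configurations are extensional functions, so that the point set of the full shift
  is \<open>carrier G \<rightarrow>\<^sub>E A\<close>.
\<close>

definition full_shift :: "('g, 'c) monoid_scheme \<Rightarrow> 'a set \<Rightarrow> ('g \<Rightarrow> 'a) topology" where
  "full_shift G A = product_topology (\<lambda>_. discrete_topology A) (carrier G)"

definition shift_act :: "('g, 'c) monoid_scheme \<Rightarrow> 'g \<Rightarrow> ('g \<Rightarrow> 'a) \<Rightarrow> 'g \<Rightarrow> 'a" where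
  "shift_act G g x = (\<lambda>h\<in>carrier G. x (inv\<^bsub>G\<^esub> g \<otimes>\<^bsub>G\<^esub> h))"

definition subshift :: "('g, 'c) monoid_scheme \<Rightarrow> 'a set \<Rightarrow> ('g \<Rightarrow> 'a) set \<Rightarrow> bool" where
  "subshift G A X \<longleftrightarrow>
     finite A \<and> closedin (full_shift G A) X \<and>
     (\<forall>g\<in>carrier G. \<forall>x\<in>X. shift_act G g x \<in> X)"

definition sft :: "('g, 'c) monoid_scheme \<Rightarrow> 'a set \<Rightarrow> ('g \<Rightarrow> 'a) set \<Rightarrow> bool" where
  "sft G A X \<longleftrightarrow>
     subshift G A X \<and>
     (\<exists>C. openin (full_shift G A) C \<and> closedin (full_shift G A) C \<and>
          X = {x \<in> topspace (full_shift G A). \<forall>g\<in>carrier G. shift_act G g x \<notin> C})"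

text \<open>
  The alphabet \<open>A\<close> of the covering SFT may be any finite set; up to renaming of
  symbols it is a finite set of natural numbers.
\<close>

definition sofic_shift :: "('g, 'c) monoid_scheme \<Rightarrow> 'b set \<Rightarrow> ('g \<Rightarrow> 'b) set \<Rightarrow> bool" where
  "sofic_shift G B Y \<longleftrightarrow>
     subshift G B Y \<and>
     (\<exists>(A :: nat set) X \<phi>.
        sft G A X \<and>
        continuous_map (subtopology (full_shift G A) X) (subtopology (full_shift G B) Y) \<phi> \<and>
        (\<forall>g\<in>carrier G. \<forall>x\<in>X. \<phi> (shift_act G g x) = shift_act G g (\<phi> x)) \<and>
        \<phi> ` X = Y)"

definition minimal_subshift :: "('g, 'c) monoid_scheme \<Rightarrow> 'b set \<Rightarrow> ('g \<Rightarrow> 'b) set \<Rightarrow> bool" where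
  "minimal_subshift G B Y \<longleftrightarrow>
     subshift G B Y \<and> Y \<noteq> {} \<and>
     (\<forall>Z. subshift G B Z \<and> Z \<subseteq> Y \<and> Z \<noteq> {} \<longrightarrow> Z = Y)"

lemma shift_act_closed:
  assumes "Group.group G" "g \<in> carrier G" "x \<in> topspace (full_shift G A)"
  shows "shift_act G g x \<in> topspace (full_shift G A)"
proof -
  interpret Group.group G by (rule assms)
  show ?thesis
    using assms(2,3) by (auto simp: full_shift_def shift_act_def PiE_iff)
qed

lemma shift_act_mult:
  assumes "Group.group G" "g \<in> carrier G" "h \<in> carrier G"
  shows "shift_act G (g \<otimes>\<^bsub>G\<^esub> h) x = shift_act G g (shift_act G h x)"
proof -
  interpret Group.group G by (rule assms)
  show ?thesis
    using assms(2,3) by (auto simp: shift_act_def inv_mult_group m_assoc fun_eq_iff)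
qed

end

theory Submission
  imports Defs
begin

text \<open>
  Let \<open>p\<close> map the free group on \<open>a, b, c, d\<close> onto the one on \<open>a, b, c\<close> by killing \<open>d\<close>, and let
  \<open>\<theta> f\<close> fix \<open>a, b, c\<close> and the factor \<open>F2\<close> and send \<open>d\<close> to \<open>d \<rho>(f)\<close>, where \<open>\<rho>\<close> embeds \<open>Finf\<close>
  into the free group on \<open>a, b\<close>. A point of the sofic shift \<open>Y\<close> is an independent choice, for each
  \<open>f\<close>, of an infinite reduced word \<open>\<xi> f\<close> in \<open>a, b, c\<close>; at \<open>((u, v), f)\<close> it shows the first letter
  of \<open>p(\<theta> f\<^sup>-\<^sup>1 u)\<^sup>-\<^sup>1 \<xi> f\<close>.

  Minimality: on the different cosets \<open>F4\<close> acts on the boundary through homomorphisms whose kernels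
  do not contain one another. Commutators then produce elements acting trivially on all but one of
  finitely many cosets, and a conjugate of such an element moves the remaining boundary point into
  any prescribed cylinder.

  Soficness: the only condition on \<open>Y\<close> that is not local is invariance under the normal closure of
  \<open>d\<close>. Writing the whole infinite word along rays of the factor \<open>F2\<close> makes it local: neighbouring
  copies of the word differ by a shift of one cell, or agree in the direction \<open>d\<close>.
\<close>

section \<open>Words and free groups\<close>

definition inv_word :: "'a word \<Rightarrow> 'a word" where
  "inv_word w = rev (map inv_letter w)"

lemma inv_letter_eq_iff [simp]: "inv_letter l = inv_letter m \<longleftrightarrow> l = m"
  by (metis inv_letter_inv_letter)

lemma inv_word_simps [simp]:
  "inv_word [] = []" "inv_word [l] = [inv_letter l]" "inv_word (u @ v) = inv_word v @ inv_word u"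
  "inv_word w = [] \<longleftrightarrow> w = []" "length (inv_word w) = length w"
  by (simp_all add: inv_word_def)

lemma fst_set_inv_word [simp]: "fst ` set (inv_word w) = fst ` set w"
  by (force simp: inv_word_def image_iff)

lemma hd_inv_word: "w \<noteq> [] \<Longrightarrow> hd (inv_word w) = inv_letter (last w)"
  by (simp add: inv_word_def hd_rev last_map)

lemma last_inv_word: "w \<noteq> [] \<Longrightarrow> last (inv_word w) = inv_letter (hd w)"
  by (simp add: inv_word_def last_rev hd_map)

lemma reduced_inv_word: "reduced_word w \<Longrightarrow> reduced_word (inv_word w)"
  by (simp add: inv_word_def reduced_inv)

lemma reduced_append:
  "reduced_word (u @ v) \<longleftrightarrow>
     reduced_word u \<and> reduced_word v \<and> (u = [] \<or> v = [] \<or> hd v \<noteq> inv_letter (last u))"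
  by (auto simp: reduced_word_def successively_append_iff)

lemma reduced_single [simp]: "reduced_word [l]"
  by (simp add: reduced_word_def)

lemma free_mult [simp]: "u \<otimes>\<^bsub>free_group S\<^esub> v = foldr lmult u v"
  by (simp add: free_group_def)

lemma free_one [simp]: "\<one>\<^bsub>free_group S\<^esub> = []"
  by (simp add: free_group_def)

lemma free_carrier: "w \<in> carrier (free_group S) \<longleftrightarrow> reduced_word w \<and> fst ` set w \<subseteq> S"
  by (simp add: free_group_def)

lemma free_inv [simp]:
  assumes "w \<in> carrier (free_group S)"
  shows "inv\<^bsub>free_group S\<^esub> w = inv_word w"
proof -
  interpret F: Group.group "free_group S" by (rule group_free_group)
  have "inv_word w \<in> carrier (free_group S)"
    using assms by (simp add: free_carrier reduced_inv_word)
  moreover have "inv_word w \<otimes>\<^bsub>free_group S\<^esub> w = \<one>\<^bsub>free_group S\<^esub>"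
    using assms foldr_lmult_inv[of "[]" w] by (simp add: free_carrier foldr_lmult_Nil inv_word_def)
  ultimately show ?thesis using assms by (intro F.inv_equality)
qed

lemma foldr_lmult_append:
  "reduced_word (u @ v) \<Longrightarrow> foldr lmult u v = u @ v"
  by (induction u) (auto simp: lmult_reduced reduced_Cons)

lemma foldr_lmult_append3:
  "reduced_word (u @ v @ w) \<Longrightarrow> foldr lmult u v = u @ v"
  by (rule foldr_lmult_append) (auto simp: reduced_append)

lemma free_single_closed [simp]: "[l] \<in> carrier (free_group S) \<longleftrightarrow> fst l \<in> S"
  by (simp add: free_carrier)

lemma free_carrier_mono: "S \<subseteq> T \<Longrightarrow> w \<in> carrier (free_group S) \<Longrightarrow> w \<in> carrier (free_group T)"
  by (auto simp: free_carrier)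

lemma hom_free_group_eqI:
  assumes "Group.group G" and "h \<in> hom (free_group S) G" "k \<in> hom (free_group S) G"
    and "\<And>s. s \<in> S \<Longrightarrow> h [(s, True)] = k [(s, True)]" and "w \<in> carrier (free_group S)"
  shows "h w = k w"
proof -
  have "(\<lambda>s. k [(s, True)]) \<in> S \<rightarrow> carrier G"
    using assms(3) by (auto simp: hom_def)
  then show ?thesis
  proof (rule free_group_universal[OF assms(1)])
    fix e
    assume e: "\<And>k' w. \<lbrakk>k' \<in> hom (free_group S) G; \<And>s. s \<in> S \<Longrightarrow> k' [(s, True)] = k [(s, True)];
       w \<in> carrier (free_group S)\<rbrakk> \<Longrightarrow> k' w = e w"
    from e[OF assms(2,4,5)] e[OF assms(3) refl assms(5)] show ?thesis by simp
  qed
qed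

lemma hom_free_group_exists:
  assumes "Group.group G" and "f \<in> S \<rightarrow> carrier G"
  shows "\<exists>h\<in>hom (free_group S) G. \<forall>s\<in>S. h [(s, True)] = f s"
  using assms(2)
proof (rule free_group_universal[OF assms(1)])
  fix h assume "h \<in> hom (free_group S) G" "\<And>s. s \<in> S \<Longrightarrow> h [(s, True)] = f s"
  then show ?thesis by blast
qed

text \<open>Beyond prepending a letter, \<open>lmult\<close> only cancels a letter against its
  inverse, and the second hypothesis covers exactly such a pair. This serves both
  \<open>lact\<close> on the boundary and \<open>T\<close> in
  \<open>conjugates_free\<close>.\<close>

lemma foldr_lmult_action:
  assumes "\<And>l x. x \<in> D \<Longrightarrow> act l x \<in> D" and "\<And>l x. x \<in> D \<Longrightarrow> act (inv_letter l) (act l x) = x"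
    and x: "x \<in> D"
  shows "foldr act (foldr lmult u v) x = foldr act u (foldr act v x)"
proof -
  have D: "foldr act w x \<in> D" for w
    using assms by (induction w) auto
  have "foldr act (lmult l w) x = act l (foldr act w x)" for l w
  proof (cases w)
    case (Cons m w')
    then show ?thesis using assms(2)[OF D[of w'], of "inv_letter l"] by auto
  qed simp
  then show ?thesis by (induction u) auto
qed

text \<open>The commutator of \<open>x u x^-1\<close> with \<open>w\<close> has seven junctions, but
  together they forbid only four letters \<open>x\<close>.\<close>

lemma commutator_reduced:
  assumes "reduced_word u" "u \<noteq> []" "reduced_word w" "w \<noteq> []"
    and "x \<notin> {inv_letter (hd u), last u, hd w, inv_letter (last w)}"
  shows "reduced_word ([x] @ u @ [inv_letter x] @ w @ [x] @ inv_word u @ [inv_letter x] @ inv_word w)"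
proof -
  have "hd u \<noteq> inv_letter x" "last u \<noteq> x" "x \<noteq> inv_letter (last w)" "inv_letter (last w) \<noteq> x"
    "inv_letter x \<noteq> inv_letter (last u)" "hd w \<noteq> x" "inv_letter x \<noteq> hd u"
    using assms(5) by (auto simp del: inv_letter_eq_iff) (metis inv_letter_inv_letter)+
  with assms show ?thesis
    by (simp add: reduced_append reduced_Cons reduced_inv_word hd_inv_word last_inv_word)
qed

text \<open>Rank three provides six letters, so four exclusions leave a choice; in rank two they
  could exhaust the letters.\<close>

lemma avoid_four_letters:
  obtains t :: "nat \<times> bool" where "fst t < 3" "t \<notin> {x1, x2, x3, x4}"
proof -
  have "card {x1, x2, x3, x4} \<le> 4"
    using card_length[of "[x1, x2, x3, x4]"] by simp
  moreover have "card ({..<3::nat} \<times> (UNIV :: bool set)) = 6" by (simp add: card_cartesian_product)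
  ultimately have "\<not> {..<3::nat} \<times> (UNIV :: bool set) \<subseteq> {x1, x2, x3, x4}"
    using card_mono[of "{x1, x2, x3, x4}" "{..<3::nat} \<times> (UNIV :: bool set)"] by auto
  then show thesis using that by force
qed

section \<open>The boundary of the free group of rank three\<close>

definition bdry :: "(nat \<Rightarrow> nat \<times> bool) set" where
  "bdry = {\<xi>. \<forall>n. fst (\<xi> n) < 3 \<and> \<xi> (Suc n) \<noteq> inv_letter (\<xi> n)}"

text \<open>Left multiplication of an infinite reduced word by a letter. The generator 3, which is
  \<open>d\<close>, acts as the identity, so that words of F4 act through \<open>p\<close>.\<close>

definition lact :: "nat \<times> bool \<Rightarrow> (nat \<Rightarrow> nat \<times> bool) \<Rightarrow> nat \<Rightarrow> nat \<times> bool" where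
  "lact l \<xi> = (if fst l < 3 then if \<xi> 0 = inv_letter l then \<xi> \<circ> Suc else case_nat l \<xi> else \<xi>)"

lemma lact_closed: "\<xi> \<in> bdry \<Longrightarrow> lact l \<xi> \<in> bdry"
  by (auto simp: bdry_def lact_def split: nat.splits)

lemma lact_cancel: "\<xi> \<in> bdry \<Longrightarrow> lact (inv_letter l) (lact l \<xi>) = \<xi>"
proof -
  assume \<xi>: "\<xi> \<in> bdry"
  then have "\<xi> (Suc 0) \<noteq> inv_letter (\<xi> 0)" by (simp add: bdry_def)
  then show ?thesis
    by (auto simp: lact_def fun_eq_iff split: nat.splits)
qed

abbreviation act :: "nat word \<Rightarrow> (nat \<Rightarrow> nat \<times> bool) \<Rightarrow> nat \<Rightarrow> nat \<times> bool" where
  "act \<equiv> foldr lact"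

lemma act_closed: "\<xi> \<in> bdry \<Longrightarrow> act w \<xi> \<in> bdry"
  by (induction w) (auto simp: lact_closed)

lemma act_mult: "\<xi> \<in> bdry \<Longrightarrow> act (foldr lmult u v) \<xi> = act u (act v \<xi>)"
  by (rule foldr_lmult_action[where D = bdry]) (auto simp: lact_closed lact_cancel)

text \<open>Nothing cancels inside \<open>w\<close> or where it meets \<open>\<xi>\<close>, so each
  letter in turn is merely prepended.\<close>

lemma act_prefix:
  assumes "reduced_word w" "fst ` set w \<subseteq> {..<3}" "w \<noteq> [] \<Longrightarrow> \<xi> 0 \<noteq> inv_letter (last w)" "n < length w"
  shows "act w \<xi> n = w ! n"
  using assms
proof (induction w arbitrary: n)
  case (Cons l w)
  have "act w \<xi> 0 \<noteq> inv_letter l"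
  proof (cases "w = []")
    case False
    then have "act w \<xi> 0 = hd w"
      using Cons by (auto simp: reduced_Cons hd_conv_nth)
    then show ?thesis using Cons.prems False by (auto simp: reduced_Cons)
  qed (use Cons in auto)
  then have *: "act (l # w) \<xi> = case_nat l (act w \<xi>)"
    using Cons.prems by (auto simp: lact_def)
  show ?case
  proof (cases n)
    case (Suc n')
    then have "act w \<xi> n' = w ! n'"
      using Cons by (intro Cons.IH) (auto simp: reduced_Cons)
    then show ?thesis using Suc * by simp
  qed (use * in simp)
qed simp

text \<open>Each letter of \<open>w\<close> moves the cells by at most one place and so widens the
  relevant window by one.\<close>

lemma act_cong:
  assumes "\<And>n. n < k + length w \<Longrightarrow> \<xi> n = \<eta> n" "n < k"
  shows "act w \<xi> n = act w \<eta> n"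
  using assms
proof (induction w arbitrary: n k)
  case (Cons l w)
  have lact_cong: "lact l \<sigma> n = lact l \<tau> n" if "\<And>m. m \<le> Suc n \<Longrightarrow> \<sigma> m = \<tau> m" for \<sigma> \<tau>
    using that[of 0] that[of n] that[of "Suc n"] that[of "n - 1"]
    by (auto simp: lact_def split: nat.splits)
  show ?case
    using Cons.prems by (auto intro!: lact_cong Cons.IH[of "Suc k"])
qed auto

section \<open>Moving boundary points independently through several retractions\<close>

text \<open>\<open>K j\<close> witnesses that the kernel of \<open>P j\<close> is contained in no
  other kernel of the family. It will be applied with \<open>p\<close> after
  \<open>\<alpha> f^-1\<close> as \<open>P f\<close> and with \<open>\<alpha> f d\<close> as
  \<open>K f\<close>.\<close>

locale separated_retractions =
  fixes I :: "'i set" and P :: "'i \<Rightarrow> nat word \<Rightarrow> nat word" and K :: "'i \<Rightarrow> nat word"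
  assumes hom: "\<And>j. j \<in> I \<Longrightarrow> P j \<in> hom (free_group {..<4}) (free_group {..<3})"
    and retr: "\<And>j w. j \<in> I \<Longrightarrow> w \<in> carrier (free_group {..<3}) \<Longrightarrow> P j w = w"
    and K: "\<And>j. j \<in> I \<Longrightarrow> K j \<in> carrier (free_group {..<4})" "\<And>j. j \<in> I \<Longrightarrow> P j (K j) = []"
      "\<And>i j. i \<in> I \<Longrightarrow> j \<in> I \<Longrightarrow> i \<noteq> j \<Longrightarrow> P i (K j) \<noteq> []"
begin

lemma group_hom: "j \<in> I \<Longrightarrow> group_hom (free_group {..<4}) (free_group {..<3}) (P j)"
  using hom by (simp add: group_hom_def group_hom_axioms_def group_free_group)

text \<open>Induction on \<open>J\<close> with commutators: if \<open>m\<close> is killed on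
  \<open>J\<close>, and \<open>K j\<close> by \<open>P j\<close>, then the commutator of a conjugate
  of \<open>K j\<close> with \<open>m\<close> is killed on \<open>J\<close> and by
  \<open>P j\<close>. The conjugating letter \<open>x\<close>, which \<open>P i\<close> fixes, is
  chosen so that the image under \<open>P i\<close> is a nonempty reduced word.\<close>

lemma kernel_element:
  assumes "finite J" "J \<subseteq> I" "i \<in> I" "i \<notin> J"
  shows "\<exists>m\<in>carrier (free_group {..<4}). (\<forall>j\<in>J. P j m = []) \<and> P i m \<noteq> []"
  using assms
proof (induction J rule: finite_induct)
  case empty
  have "[(0, True)] \<in> carrier (free_group {..<3::nat})" "[(0, True)] \<in> carrier (free_group {..<4::nat})"
    by auto
  then show ?case using retr[OF empty(2)]
    by (intro bexI[of _ "[(0, True)]"]) auto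
next
  case (insert j J)
  let ?F = "free_group {..<4 :: nat}" and ?Q = "free_group {..<3 :: nat}"
  interpret F: Group.group ?F by (rule group_free_group)
  interpret Q: Group.group ?Q by (rule group_free_group)
  have h: "group_hom ?F ?Q (P k)" if "k \<in> I" for k
    using group_hom[OF that] .
  obtain m where m: "m \<in> carrier ?F" "\<forall>j\<in>J. P j m = []" "P i m \<noteq> []"
    using insert by auto
  define u where "u = P i (K j)"
  define w where "w = P i m"
  have j: "j \<in> I" "i \<noteq> j" "i \<in> I" using insert.prems by auto
  have ne: "u \<noteq> []" "w \<noteq> []" using K(3)[of i j] j m by (auto simp: u_def w_def)
  have cl: "u \<in> carrier ?Q" "w \<in> carrier ?Q"
    using group_hom.hom_closed[OF h] K(1) m(1) j unfolding u_def w_def by blast+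
  have red: "reduced_word u" "reduced_word w" using cl by (auto simp: free_carrier)
  obtain x :: "nat \<times> bool" where x: "fst x < 3" "x \<notin> {inv_letter (hd u), last u, hd w, inv_letter (last w)}"
    by (rule avoid_four_letters)
  have xc: "[x] \<in> carrier ?F" "[x] \<in> carrier ?Q" using x by auto
  define c where "c = [x] \<otimes>\<^bsub>?F\<^esub> K j \<otimes>\<^bsub>?F\<^esub> inv\<^bsub>?F\<^esub> [x]"
  define m' where "m' = c \<otimes>\<^bsub>?F\<^esub> m \<otimes>\<^bsub>?F\<^esub> inv\<^bsub>?F\<^esub> c \<otimes>\<^bsub>?F\<^esub> inv\<^bsub>?F\<^esub> m"
  have c: "c \<in> carrier ?F" using xc K(1)[OF j(1)] unfolding c_def by (intro F.m_closed F.inv_closed)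
  have m': "m' \<in> carrier ?F" using c m(1) unfolding m'_def by (intro F.m_closed F.inv_closed)
  have Pc: "P k c = [x] \<otimes>\<^bsub>?Q\<^esub> P k (K j) \<otimes>\<^bsub>?Q\<^esub> inv\<^bsub>?Q\<^esub> [x]" if "k \<in> I" for k
  proof -
    interpret P: group_hom ?F ?Q "P k" by (rule h[OF that])
    show ?thesis
      unfolding c_def using xc K(1)[OF j(1)] retr[OF that xc(2)]
      by (metis P.hom_inv P.hom_mult F.m_closed F.inv_closed)
  qed
  have Pm': "P k m' = P k c \<otimes>\<^bsub>?Q\<^esub> P k m \<otimes>\<^bsub>?Q\<^esub> inv\<^bsub>?Q\<^esub> P k c \<otimes>\<^bsub>?Q\<^esub> inv\<^bsub>?Q\<^esub> P k m" if "k \<in> I" for k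
  proof -
    interpret P: group_hom ?F ?Q "P k" by (rule h[OF that])
    show ?thesis
      unfolding m'_def using c m(1)
      by (metis P.hom_inv P.hom_mult F.m_closed F.inv_closed)
  qed
  have Pcl: "P k c \<in> carrier ?Q" "P k m \<in> carrier ?Q" if "k \<in> I" for k
    using group_hom.hom_closed[OF h[OF that]] c m(1) by blast+
  have "P j m' = []"
  proof -
    have "P j c = \<one>\<^bsub>?Q\<^esub>"
      using Pc[OF j(1)] K(2)[OF j(1)] xc(2) Q.r_inv[OF xc(2)] Q.r_one[OF xc(2)] by (metis free_one)
    then have "P j m' = \<one>\<^bsub>?Q\<^esub>"
      using Pm'[OF j(1)] Pcl[OF j(1)] by (simp only: Q.inv_one Q.l_one Q.r_one Q.r_inv)
    then show ?thesis by simp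
  qed
  moreover have "P k m' = []" if "k \<in> J" for k
  proof -
    have k: "k \<in> I" using that insert.prems by auto
    have "P k m = \<one>\<^bsub>?Q\<^esub>" using m(2) that by simp
    then have "P k m' = \<one>\<^bsub>?Q\<^esub>"
      using Pm'[OF k] Pcl[OF k] by (simp only: Q.inv_one Q.l_one Q.r_one Q.r_inv)
    then show ?thesis by simp
  qed
  moreover have "P i m' \<noteq> []"
  proof -
    \<comment> \<open>\<open>?c'\<close> is the inverse of \<open>P i c\<close>, and
      \<open>?W\<close> is the expected image of \<open>m'\<close>. As \<open>?W\<close> is reduced,
      the partial products are plain concatenations.\<close>
    let ?c' = "[x] @ inv_word u @ [inv_letter x]" and ?w' = "inv_word w"
    let ?W = "[x] @ u @ [inv_letter x] @ w @ ?c' @ ?w'"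
    have W: "reduced_word ?W"
      using commutator_reduced[OF red(1) ne(1) red(2) ne(2) x(2)] by simp
    have Pc': "P i c = [x] @ u @ [inv_letter x]"
      using Pc[OF j(3)] xc W foldr_lmult_append3[of "[x]" u "[inv_letter x] @ w @ ?c' @ ?w'"]
        foldr_lmult_append3[of "[x] @ u" "[inv_letter x]" "w @ ?c' @ ?w'"]
      by (simp add: u_def del: foldr.simps)
    have "inv\<^bsub>?Q\<^esub> P i c = ?c'" "inv\<^bsub>?Q\<^esub> w = ?w'"
      using Pcl(1)[OF j(3)] cl(2) inv_word_simps(3)[of "[x]" "u @ [inv_letter x]"] unfolding Pc'
      by simp_all
    then have "P i m' = ?W"
      using Pm'[OF j(3)] W foldr_lmult_append3[of "P i c" w "?c' @ ?w'"]
        foldr_lmult_append3[of "P i c @ w" ?c' ?w'] foldr_lmult_append[of "P i c @ w @ ?c'" ?w']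
      by (simp add: Pc' w_def[symmetric] del: foldr.simps)
    then show ?thesis by simp
  qed
  ultimately show ?case using m' by auto
qed

text \<open>Conjugates of an element killed by all other retractions are still killed by them. Under
  \<open>P i\<close> the conjugate by \<open>v t\<close> acts as \<open>v t w t^-1 v^-1\<close>, and
  for a suitable letter \<open>t\<close> nothing cancels to the left of
  \<open>t^-1 v^-1 \<xi>\<close>, so that the result begins with \<open>v\<close>.\<close>

lemma move_one:
  assumes "finite I" and i: "i \<in> I" and \<xi>: "\<xi> \<in> bdry"
    and v: "reduced_word v" "fst ` set v \<subseteq> {..<3}" "v \<noteq> []"
  shows "\<exists>m\<in>carrier (free_group {..<4}). (\<forall>j\<in>I - {i}. P j m = []) \<and>
           (\<forall>n<length v. act (P i m) \<xi> n = v ! n)"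
proof -
  let ?F = "free_group {..<4 :: nat}" and ?Q = "free_group {..<3 :: nat}"
  interpret F: Group.group ?F by (rule group_free_group)
  interpret Q: Group.group ?Q by (rule group_free_group)
  obtain k where k: "k \<in> carrier ?F" "\<forall>j\<in>I - {i}. P j k = []" "P i k \<noteq> []"
    using kernel_element[of "I - {i}" i] assms by auto
  define w where "w = P i k"
  define \<eta> where "\<eta> = act (inv_word v) \<xi>"
  have \<eta>: "\<eta> \<in> bdry" unfolding \<eta>_def by (rule act_closed[OF \<xi>])
  have w: "w \<in> carrier ?Q" "w \<noteq> []"
    using group_hom.hom_closed[OF group_hom[OF i] k(1)] k(3) by (auto simp: w_def)
  \<comment> \<open>In the listed order the exclusions prevent cancellation of \<open>t^-1\<close>
    with \<open>\<eta>\<close>, of \<open>w\<close> with \<open>t^-1\<close>, of \<open>t\<close>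
    with \<open>w\<close>, and of \<open>v\<close> with \<open>t\<close>.\<close>
  obtain t :: "nat \<times> bool" where t: "fst t < 3"
    "t \<notin> {\<eta> 0, last w, inv_letter (hd w), inv_letter (last v)}"
    by (rule avoid_four_letters)
  have t': "hd w \<noteq> inv_letter t" using t(2) inv_letter_inv_letter[of "hd w"] by auto
  define c where "c = v @ [t]"
  have red: "reduced_word (c @ w)"
    using v w t t' by (auto simp: c_def reduced_append reduced_Cons free_carrier)
  have c: "c \<in> carrier ?F" "c \<in> carrier ?Q"
    using red v t by (auto simp: free_carrier c_def reduced_append)
  define m where "m = c \<otimes>\<^bsub>?F\<^esub> k \<otimes>\<^bsub>?F\<^esub> inv\<^bsub>?F\<^esub> c"
  have m: "m \<in> carrier ?F" using c k(1) unfolding m_def by (intro F.m_closed F.inv_closed)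
  have Pm: "P j m = c \<otimes>\<^bsub>?Q\<^esub> P j k \<otimes>\<^bsub>?Q\<^esub> inv\<^bsub>?Q\<^esub> c" if "j \<in> I" for j
  proof -
    interpret P: group_hom ?F ?Q "P j" by (rule group_hom[OF that])
    show ?thesis
      unfolding m_def using c k(1) retr[OF that c(2)]
      by (metis P.hom_inv P.hom_mult F.m_closed F.inv_closed)
  qed
  have "P j m = []" if "j \<in> I - {i}" for j
  proof -
    have "P j k = \<one>\<^bsub>?Q\<^esub>" using k that by simp
    then have "P j m = \<one>\<^bsub>?Q\<^esub>"
      using Pm[of j] that c(2) by (simp only: Q.r_one Q.r_inv DiffD1)
    then show ?thesis by simp
  qed
  moreover have "act (P i m) \<xi> n = v ! n" if "n < length v" for n
  proof -
    define \<zeta> where "\<zeta> = lact (inv_letter t) \<eta>"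
    have \<zeta>: "\<zeta> 0 = inv_letter t" using t by (auto simp: \<zeta>_def lact_def)
    have "inv\<^bsub>?Q\<^esub> c = [inv_letter t] @ inv_word v" using c by (simp add: c_def)
    then have "act (P i m) \<xi> = act ((c \<otimes>\<^bsub>?Q\<^esub> w) \<otimes>\<^bsub>?Q\<^esub> ([inv_letter t] @ inv_word v)) \<xi>"
      using Pm[OF i] by (simp add: w_def)
    also have "\<dots> = act (c @ w) \<zeta>"
      unfolding free_mult act_mult[OF \<xi>]
      using red by (simp add: \<zeta>_def \<eta>_def foldr_lmult_append)
    finally have "act (P i m) \<xi> n = act (c @ w) \<zeta> n" by simp
    also have "\<dots> = (c @ w) ! n"
      using red c w that t \<zeta> by (intro act_prefix) (auto simp: free_carrier c_def)
    finally show ?thesis using that by (simp add: c_def nth_append)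
  qed
  ultimately show ?thesis using m by blast
qed

text \<open>The indices are treated one at a time: the factor that moves \<open>\<xi> i\<close> acts
  trivially at every other index, so it does not spoil what was achieved before.\<close>

lemma move_all:
  assumes "finite I" and \<xi>: "\<And>i. i \<in> I \<Longrightarrow> \<xi> i \<in> bdry"
    and v: "\<And>i. i \<in> I \<Longrightarrow> reduced_word (v i) \<and> fst ` set (v i) \<subseteq> {..<3} \<and> v i \<noteq> []"
  shows "\<exists>m\<in>carrier (free_group {..<4}). \<forall>i\<in>I. \<forall>n<length (v i). act (P i m) (\<xi> i) n = v i ! n"
proof -
  let ?F = "free_group {..<4 :: nat}" and ?Q = "free_group {..<3 :: nat}"
  interpret F: Group.group ?F by (rule group_free_group)
  \<comment> \<open>The invariant also records that \<open>m\<close> is trivial at the indices still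
    to come, so \<open>move_one\<close> can be applied there to the original point
    \<open>\<xi> i\<close>.\<close>
  have "\<exists>m\<in>carrier ?F. (\<forall>i\<in>J. \<forall>n<length (v i). act (P i m) (\<xi> i) n = v i ! n) \<and>
      (\<forall>i\<in>I - J. P i m = [])" if "J \<subseteq> I" for J
    using finite_subset[OF that \<open>finite I\<close>] that
  proof (induction J rule: finite_induct)
    case empty
    have "P i [] = []" if "i \<in> I" for i
      using group_hom.hom_one[OF group_hom[OF that]] by simp
    then show ?case by (intro bexI[of _ "[]"]) (auto simp: free_carrier)
  next
    case (insert i J)
    then have i: "i \<in> I" by simp
    obtain m where m: "m \<in> carrier ?F" "\<forall>i\<in>J. \<forall>n<length (v i). act (P i m) (\<xi> i) n = v i ! n"
      "\<forall>i\<in>I - J. P i m = []"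
      using insert by auto
    obtain k where k: "k \<in> carrier ?F" "\<forall>j\<in>I - {i}. P j k = []"
      "\<forall>n<length (v i). act (P i k) (\<xi> i) n = v i ! n"
      using move_one[OF \<open>finite I\<close> i \<xi>[OF i]] v[OF i] by blast
    have P: "P j (k \<otimes>\<^bsub>?F\<^esub> m) = foldr lmult (P j k) (P j m)" if "j \<in> I" for j
      using group_hom.hom_mult[OF group_hom[OF that] k(1) m(1)] by simp
    have red: "reduced_word (P j k)" if "j \<in> I" for j
      using group_hom.hom_closed[OF group_hom[OF that] k(1)] by (simp add: free_carrier)
    have "k \<otimes>\<^bsub>?F\<^esub> m \<in> carrier ?F" using k(1) m(1) by (rule F.m_closed)
    moreover have "act (P j (k \<otimes>\<^bsub>?F\<^esub> m)) (\<xi> j) n = v j ! n" if "j \<in> insert i J" "n < length (v j)" for j n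
    proof (cases "j = i")
      case True
      then show ?thesis
        using P[OF i] m(3) i insert.hyps k(3) that red[OF i] by (simp add: foldr_lmult_Nil)
    next
      case False
      then have "j \<in> J" "j \<in> I - {i}" using that insert.prems by auto
      then show ?thesis using P[of j] k(2) m(2) that by simp
    qed
    moreover have "P j (k \<otimes>\<^bsub>?F\<^esub> m) = []" if "j \<in> I - insert i J" for j
      using P[of j] that k(2) m(3) by auto
    ultimately show ?case by blast
  qed
  from this[of I] show ?thesis by auto
qed

end

section \<open>A free group of automorphisms\<close>

text \<open>The conjugates \<open>b^s a b^-s\<close> are free generators of a subgroup. That
  \<open>\<rho> f\<close> is nontrivial will tell the cosets of \<open>Finf\<close> in
  \<open>G\<close> apart.\<close>

lemma conjugates_free:
  obtains \<rho> where "\<rho> \<in> hom (free_group (UNIV :: nat set)) (free_group {..<3 :: nat})"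
    "\<And>f. f \<in> carrier (free_group UNIV) \<Longrightarrow> f \<noteq> [] \<Longrightarrow> \<rho> f \<noteq> []"
proof -
  let ?Q = "free_group {..<3 :: nat}" and ?F = "free_group (UNIV :: nat set)"
  interpret F: Group.group ?F by (rule group_free_group)
  define conj :: "nat \<Rightarrow> bool \<Rightarrow> nat word"
    where "conj s e = replicate s (1, True) @ [(0, e)] @ replicate s (1, False)" for s e
  have red: "reduced_word (replicate s l)" for s and l :: "nat \<times> bool"
    by (induction s) (auto simp: reduced_Cons)
  have conj: "conj s e \<in> carrier ?Q" for s e
    by (cases s) (auto simp: conj_def free_carrier reduced_append red reduced_Cons inv_letter_def hd_append)
  have inv_conj: "inv_word (conj s True) = conj s False" for s
    by (simp add: conj_def inv_word_def inv_letter_def)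
  obtain \<rho> where \<rho>: "\<rho> \<in> hom ?F ?Q" "\<And>s. \<rho> [(s, True)] = conj s True"
    using hom_free_group_exists[OF group_free_group[of "{..<3::nat}"], of "\<lambda>s. conj s True" UNIV] conj
    by auto
  interpret \<rho>: group_hom ?F ?Q \<rho>
    using \<rho>(1) by (simp add: group_hom_def group_hom_axioms_def group_free_group)
  have \<rho>_single: "\<rho> [(s, e)] = conj s e" for s e
  proof (cases e)
    case False
    have "inv\<^bsub>?F\<^esub> [(s, True)] = [(s, e)]" using False by (simp add: inv_letter_def)
    then show ?thesis using \<rho>.hom_inv[of "[(s, True)]"] conj[of s True] False
      by (simp add: \<rho>(2) inv_conj)
  qed (simp add: \<rho>(2))
  \<comment> \<open>Let \<open>a\<close> multiply words over the integers by the generator \<open>0\<close> and \<open>b\<close> translate the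
      generators by one. Then \<open>b\<^sup>s a b\<^sup>-\<^sup>s\<close> multiplies by the generator \<open>s\<close>, so a word \<open>f\<close> is
      recovered by applying \<open>\<rho> f\<close> to the empty word.\<close>
  define shift :: "int \<Rightarrow> int word \<Rightarrow> int word" where "shift d = map (apfst (\<lambda>i. i + d))" for d
  define T :: "nat \<times> bool \<Rightarrow> int word \<Rightarrow> int word"
    where "T l = (if fst l = 0 then lmult (0, snd l)
      else if fst l = 1 then shift (if snd l then 1 else -1) else id)" for l
  have apfst_inv: "apfst (\<lambda>i. i + d) m = inv_letter (apfst (\<lambda>i. i + d) l) \<longleftrightarrow> m = inv_letter l"
    for l m :: "int \<times> bool" and d
    by (cases l; cases m) (auto simp: inv_letter_def)
  have shift_red: "reduced_word (shift d x) \<longleftrightarrow> reduced_word x" for d x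
    by (simp add: reduced_word_def shift_def successively_map apfst_inv)
  have shift_lmult: "shift d (lmult (i, e) x) = lmult (i + d, e) (shift d x)" for d i e x
    using apfst_inv[of d _ "(i, e)"] by (cases x) (auto simp: shift_def)
  have shift_shift: "shift d (shift d' x) = shift (d + d') x" "shift 0 x = x" for d d' x
    by (auto simp: shift_def apfst_def map_prod_def split_def add_ac)
  have T_D: "T l x \<in> Collect reduced_word" if "x \<in> Collect reduced_word" for l x
    using that by (auto simp: T_def reduced_lmult shift_red)
  \<comment> \<open>Indexing the generators by integers makes the translation invertible on all
    words.\<close>
  have T_inv: "T (inv_letter l) (T l x) = x" if "x \<in> Collect reduced_word" for l x
    using that lmult_cancel[of x "(0, snd l)"]
    by (auto simp: T_def shift_shift) (auto simp: inv_letter_def)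
  have "foldr T (replicate s (1, e)) x = shift (if e then int s else - int s) x" for s e x
    by (induction s) (auto simp: T_def shift_shift)
  then have T_conj: "foldr T (conj s e) x = lmult (int s, e) x" for s e x
    by (simp add: conj_def T_def[of "(0, _)"] shift_lmult shift_shift)
  have T_mult: "foldr T (foldr lmult u v) x = foldr T u (foldr T v x)" if "reduced_word x" for u v x
    using that by (intro foldr_lmult_action[of "Collect reduced_word"] T_D T_inv) auto
  have main: "foldr T (\<rho> f) [] = map (apfst int) f" if "f \<in> carrier ?F" for f
    using that
  proof (induction f)
    case Nil
    then show ?case using \<rho>.hom_one by simp
  next
    case (Cons l f)
    have f: "f \<in> carrier ?F" and red: "reduced_word (l # f)"
      using Cons.prems by (auto simp: free_carrier reduced_Cons)
    have "\<rho> (l # f) = foldr lmult (\<rho> [l]) (\<rho> f)"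
      using \<rho>.hom_mult[of "[l]" f] f lmult_reduced[OF red] by simp
    then have "foldr T (\<rho> (l # f)) [] = lmult (apfst int l) (map (apfst int) f)"
      using \<rho>_single[of "fst l" "snd l"] Cons.IH[OF f] T_conj T_mult[of "[]"] by (simp add: apfst_def map_prod_def split_def)
    moreover have "reduced_word (map (apfst int) (l # f))"
      using red unfolding reduced_word_def successively_map
      by (rule successively_mono) (auto simp: inv_letter_def prod_eq_iff)
    ultimately show ?case by (simp add: lmult_reduced)
  qed
  show thesis
  proof (rule that[OF \<rho>(1)])
    fix f assume "f \<in> carrier ?F" "f \<noteq> []"
    then show "\<rho> f \<noteq> []" using main[of f] by auto
  qed
qed


text \<open>\<open>\<alpha> f\<close> is \<open>A (\<rho> f)\<close>, where \<open>A w\<close> fixes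
  \<open>a, b, c\<close> and sends \<open>d\<close> to \<open>d w\<close>. As \<open>A v\<close>
  fixes \<open>w\<close>, it sends \<open>d w\<close> to \<open>d v w\<close>, so these twists
  compose as their words multiply. Applying \<open>p\<close> to the image of \<open>d\<close>
  returns \<open>\<rho> f\<close>.\<close>

lemma twisting_automorphisms:
  obtains p \<alpha> where "p \<in> hom (free_group {..<4 :: nat}) (free_group {..<3 :: nat})"
    "\<And>w. w \<in> carrier (free_group {..<3}) \<Longrightarrow> p w = w" "p [(3, True)] = []"
    "\<And>f. f \<in> carrier (free_group (UNIV :: nat set)) \<Longrightarrow> \<alpha> f \<in> hom (free_group {..<4 :: nat}) (free_group {..<4})"
    "\<And>f g u. \<lbrakk>f \<in> carrier (free_group UNIV); g \<in> carrier (free_group UNIV); u \<in> carrier (free_group {..<4})\<rbrakk>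
      \<Longrightarrow> \<alpha> (f \<otimes>\<^bsub>free_group UNIV\<^esub> g) u = \<alpha> f (\<alpha> g u)"
    "\<And>u. u \<in> carrier (free_group {..<4}) \<Longrightarrow> \<alpha> [] u = u"
    "\<And>f w. \<lbrakk>f \<in> carrier (free_group UNIV); w \<in> carrier (free_group {..<3})\<rbrakk> \<Longrightarrow> \<alpha> f w = w"
    "\<And>f. \<lbrakk>f \<in> carrier (free_group UNIV); f \<noteq> []\<rbrakk> \<Longrightarrow> p (\<alpha> f [(3, True)]) \<noteq> []"
proof -
  let ?F = "free_group {..<4 :: nat}" and ?Q = "free_group {..<3 :: nat}"
  interpret F: Group.group ?F by (rule group_free_group)
  interpret Q: Group.group ?Q by (rule group_free_group)
  have QF: "w \<in> carrier ?F" if "w \<in> carrier ?Q" for w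
    using that by (rule free_carrier_mono[rotated]) auto
  have hom_restrict: "h \<in> hom ?Q H" if "h \<in> hom ?F H" for h and H :: "nat word monoid"
    using that QF by (auto simp: hom_def Pi_def)
  have gens: "s < 3 \<or> s = 3" if "s \<in> {..<4 :: nat}" for s using that by auto
  have "(\<lambda>s. if s < 3 then [(s, True)] else []) \<in> {..<4 :: nat} \<rightarrow> carrier ?Q"
    by (auto simp: free_carrier)
  from hom_free_group_exists[OF group_free_group this] obtain p where p: "p \<in> hom ?F ?Q"
    "\<And>s. s \<in> {..<4} \<Longrightarrow> p [(s, True)] = (if s < 3 then [(s, True)] else [])"
    by blast
  have p_id: "p w = w" if "w \<in> carrier ?Q" for w
    using that by (rule_tac hom_free_group_eqI[OF group_free_group hom_restrict[OF p(1)], of "\<lambda>x. x"])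
      (auto simp: p(2) hom_def simp del: free_mult)
  have "\<exists>h. h \<in> hom ?F ?F \<and> (\<forall>s<3. h [(s, True)] = [(s, True)]) \<and> h [(3, True)] = [(3, True)] \<otimes>\<^bsub>?F\<^esub> w"
    if "w \<in> carrier ?Q" for w
  proof -
    have "[(3, True)] \<otimes>\<^bsub>?F\<^esub> w \<in> carrier ?F" using QF[OF that] by (intro F.m_closed) auto
    then have "(\<lambda>s. if s < 3 then [(s, True)] else [(3, True)] \<otimes>\<^bsub>?F\<^esub> w) \<in> {..<4 :: nat} \<rightarrow> carrier ?F"
      by auto
    from hom_free_group_exists[OF group_free_group this] obtain h where "h \<in> hom ?F ?F"
      "\<forall>s\<in>{..<4}. h [(s, True)] = (if s < 3 then [(s, True)] else [(3, True)] \<otimes>\<^bsub>?F\<^esub> w)"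
      by blast
    then show ?thesis by (intro exI[of _ h]) (simp del: free_mult)
  qed
  then obtain A where A: "A w \<in> hom ?F ?F" "s < 3 \<Longrightarrow> A w [(s, True)] = [(s, True)]"
    "A w [(3, True)] = [(3, True)] \<otimes>\<^bsub>?F\<^esub> w" if "w \<in> carrier ?Q" for w s
    by metis
  have id_hom: "(\<lambda>x. x) \<in> hom ?Q ?F"
    using QF by (auto simp: hom_def)
  have A_id: "A w u = u" if "w \<in> carrier ?Q" "u \<in> carrier ?Q" for w u
    using that QF by (rule_tac hom_free_group_eqI[OF group_free_group hom_restrict[OF A(1)], of _ "\<lambda>x. x"])
      (auto simp: A(2) id_hom)
  have A_mult: "A (v \<otimes>\<^bsub>?Q\<^esub> w) u = A v (A w u)"
    if "v \<in> carrier ?Q" "w \<in> carrier ?Q" "u \<in> carrier ?F" for v w u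
  proof (rule hom_free_group_eqI[OF group_free_group A(1) _ _ that(3)])
    interpret v: group_hom ?F ?F "A v"
      using A(1)[OF that(1)] by unfold_locales
    interpret w: group_hom ?F ?F "A w"
      using A(1)[OF that(2)] by unfold_locales
    show vw: "v \<otimes>\<^bsub>?Q\<^esub> w \<in> carrier ?Q" using that by (intro Q.m_closed)
    show "(\<lambda>u. A v (A w u)) \<in> hom ?F ?F"
      by (rule homI) (simp_all del: free_mult)
    fix s assume "s \<in> {..<4 :: nat}"
    show "A (v \<otimes>\<^bsub>?Q\<^esub> w) [(s, True)] = A v (A w [(s, True)])"
      using gens[OF \<open>s \<in> {..<4}\<close>]
    proof
      assume s: "s = 3"
      have "A v (A w [(s, True)]) = A v [(3, True)] \<otimes>\<^bsub>?F\<^esub> A v w"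
        unfolding s A(3)[OF that(2)] using QF[OF that(2)] by (intro v.hom_mult) auto
      also have "\<dots> = [(3, True)] \<otimes>\<^bsub>?F\<^esub> (v \<otimes>\<^bsub>?F\<^esub> w)"
        using A(3)[OF that(1)] A_id[OF that(1,2)] QF[OF that(1)] QF[OF that(2)] F.m_assoc[of "[(3, True)]" v w]
        by (simp del: free_mult)
      finally show ?thesis unfolding s A(3)[OF vw] by simp
    qed (use that vw A in \<open>simp del: free_mult\<close>)
  qed
  obtain \<rho> where \<rho>: "\<rho> \<in> hom (free_group (UNIV :: nat set)) ?Q"
    "\<And>f. f \<in> carrier (free_group UNIV) \<Longrightarrow> f \<noteq> [] \<Longrightarrow> \<rho> f \<noteq> []"
    by (rule conjugates_free) blast
  interpret \<rho>: group_hom "free_group (UNIV :: nat set)" ?Q \<rho>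
    using \<rho>(1) by (simp add: group_hom_def group_hom_axioms_def group_free_group)
  interpret p: group_hom ?F ?Q p
    using p(1) by unfold_locales
  show thesis
  proof (rule that[of p "\<lambda>f. A (\<rho> f)"])
    show "A (\<rho> (f \<otimes>\<^bsub>free_group UNIV\<^esub> g)) u = A (\<rho> f) (A (\<rho> g) u)"
      if "f \<in> carrier (free_group UNIV)" "g \<in> carrier (free_group UNIV)" "u \<in> carrier ?F" for f g u
      using that by (simp only: \<rho>.hom_mult A_mult \<rho>.hom_closed)
    show "A (\<rho> []) u = u" if "u \<in> carrier ?F" for u
    proof -
      have [simp]: "\<rho> [] = []" using \<rho>.hom_one by simp
      show ?thesis
      proof (rule hom_free_group_eqI[OF group_free_group A(1) _ _ that])
        fix s assume "s \<in> {..<4 :: nat}"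
        then show "A (\<rho> []) [(s, True)] = [(s, True)]"
          using A(2,3)[of "[]"] gens[of s] by (auto simp: free_carrier)
      qed (auto simp: free_carrier hom_def reduced_lmult reduced_foldr_lmult
          intro: subsetD[OF letters_foldr_lmult])
    qed
    show "p (A (\<rho> f) [(3, True)]) \<noteq> []" if f: "f \<in> carrier (free_group UNIV)" "f \<noteq> []" for f
    proof -
      have \<rho>f: "\<rho> f \<in> carrier ?Q" "\<rho> f \<in> carrier ?F" using f(1) QF by (simp_all only: \<rho>.hom_closed)
      have "p (A (\<rho> f) [(3, True)]) = p [(3, True)] \<otimes>\<^bsub>?Q\<^esub> p (\<rho> f)"
        unfolding A(3)[OF \<rho>f(1)] using \<rho>f by (intro p.hom_mult) auto
      also have "\<dots> = \<rho> f" using \<rho>f p_id by (simp add: p(2))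
      finally show ?thesis using \<rho>(2)[OF f] by simp
    qed
  qed (use p p_id A(1) A_id in \<open>auto simp only: \<rho>.hom_closed lessThan_iff split: if_splits\<close>)
qed

section \<open>Locally defined subshifts\<close>

lemma topspace_full_shift: "topspace (full_shift G A) = carrier G \<rightarrow>\<^sub>E A"
  by (simp add: full_shift_def)

text \<open>A predicate that reads only the finite window \<open>W\<close> holds, together with a
  point, on the whole cylinder over \<open>W\<close> around it.\<close>

lemma openin_full_shift_local:
  assumes "finite W" "W \<subseteq> carrier G" "\<And>x x'. (\<And>s. s \<in> W \<Longrightarrow> x s = x' s) \<Longrightarrow> P x \<longleftrightarrow> P x'"
  shows "openin (full_shift G A) {x \<in> topspace (full_shift G A). P x}"
  unfolding full_shift_def openin_product_topology_alt topspace_product_topology topspace_discrete_topology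
proof (intro ballI, elim CollectE conjE)
  fix x assume x: "x \<in> carrier G \<rightarrow>\<^sub>E A" "P x"
  let ?U = "\<lambda>g. if g \<in> W then {x g} else A"
  have "finite {i \<in> carrier G. ?U i \<noteq> A}"
    by (rule finite_subset[OF _ \<open>finite W\<close>]) auto
  moreover have "\<forall>i\<in>carrier G. openin (discrete_topology A) (?U i)" "x \<in> Pi\<^sub>E (carrier G) ?U"
    using x assms(2) by (auto simp: PiE_iff)
  moreover have "Pi\<^sub>E (carrier G) ?U \<subseteq> {x \<in> carrier G \<rightarrow>\<^sub>E A. P x}"
  proof
    fix z assume z: "z \<in> Pi\<^sub>E (carrier G) ?U"
    have "z i \<in> A" if "i \<in> carrier G" for i
      using PiE_mem[OF z that] PiE_mem[OF x(1) that] by (auto split: if_splits)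
    then have "z \<in> carrier G \<rightarrow>\<^sub>E A" using z by (simp add: PiE_iff)
    moreover have "z s = x s" if "s \<in> W" for s
      using PiE_mem[OF z, of s] that assms(2) by auto
    then have "P z \<longleftrightarrow> P x" by (rule assms(3))
    ultimately show "z \<in> {x \<in> carrier G \<rightarrow>\<^sub>E A. P x}" using x by simp
  qed
  ultimately show "\<exists>U. finite {i \<in> carrier G. U i \<noteq> A} \<and> (\<forall>i\<in>carrier G. openin (discrete_topology A) (U i)) \<and>
      x \<in> Pi\<^sub>E (carrier G) U \<and> Pi\<^sub>E (carrier G) U \<subseteq> {x \<in> carrier G \<rightarrow>\<^sub>E A. P x}"
    by (intro exI[of _ ?U]) simp
qed

lemma closedin_full_shift_local:
  assumes "finite W" "W \<subseteq> carrier G" "\<And>x x'. (\<And>s. s \<in> W \<Longrightarrow> x s = x' s) \<Longrightarrow> P x \<longleftrightarrow> P x'"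
  shows "closedin (full_shift G A) {x \<in> topspace (full_shift G A). P x}"
proof -
  have "openin (full_shift G A) {x \<in> topspace (full_shift G A). \<not> P x}"
    by (rule openin_full_shift_local[OF assms(1,2)]) (use assms(3) in blast)
  moreover have "topspace (full_shift G A) - {x \<in> topspace (full_shift G A). P x}
      = {x \<in> topspace (full_shift G A). \<not> P x}" by auto
  ultimately show ?thesis by (simp add: closedin_def)
qed

text \<open>These turn the families of rules in \<open>subshift_Y\<close> back into quantifiers over
  their parameters.\<close>

lemma ball_family: "(\<forall>(W, P)\<in>{(W v, P v) | v. C v}. Q P) \<longleftrightarrow> (\<forall>v. C v \<longrightarrow> Q (P v))"
  and ball_family2: "(\<forall>(W, P)\<in>{(W' v w, P' v w) | v w. C' v w}. Q' P) \<longleftrightarrow> (\<forall>v w. C' v w \<longrightarrow> Q' (P' v w))"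
  by blast+

text \<open>Rules are read at the cells \<open>g s\<close>, to the right of \<open>g\<close>, while
  the shift multiplies on the left; shifting by \<open>k\<close> merely replaces \<open>g\<close> by
  \<open>k^-1 g\<close>. There may be infinitely many rules, since arbitrary intersections of closed
  sets are closed.\<close>

lemma subshift_local:
  assumes "Group.group G" "finite A"
    and W: "\<And>W P. (W, P) \<in> I \<Longrightarrow> finite W \<and> W \<subseteq> carrier G"
    and P: "\<And>W P x x'. (W, P) \<in> I \<Longrightarrow> (\<And>s. s \<in> W \<Longrightarrow> x s = x' s) \<Longrightarrow> P x \<longleftrightarrow> P x'"
  shows "subshift G A {x \<in> topspace (full_shift G A). \<forall>(W, P)\<in>I. \<forall>g\<in>carrier G. P (\<lambda>s. x (g \<otimes>\<^bsub>G\<^esub> s))}"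
    (is "subshift G A ?X")
proof -
  interpret Group.group G by (rule assms)
  let ?T = "topspace (full_shift G A)"
  let ?C = "\<lambda>P g. {x \<in> ?T. P (\<lambda>s. x (g \<otimes>\<^bsub>G\<^esub> s))}"
  have "closedin (full_shift G A) (?C P g)" if "(W, P) \<in> I" "g \<in> carrier G" for W P g
  proof (rule closedin_full_shift_local)
    show "finite ((\<lambda>s. g \<otimes>\<^bsub>G\<^esub> s) ` W)" "(\<lambda>s. g \<otimes>\<^bsub>G\<^esub> s) ` W \<subseteq> carrier G"
      using W[OF that(1)] that(2) by auto
    show "P (\<lambda>s. x (g \<otimes>\<^bsub>G\<^esub> s)) \<longleftrightarrow> P (\<lambda>s. x' (g \<otimes>\<^bsub>G\<^esub> s))"
      if "\<And>s. s \<in> (\<lambda>s. g \<otimes>\<^bsub>G\<^esub> s) ` W \<Longrightarrow> x s = x' s" for x x' :: "'a \<Rightarrow> 'c"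
      using that by (intro P[OF \<open>(W, P) \<in> I\<close>]) auto
  qed
  \<comment> \<open>Inserting \<open>?T\<close> keeps the intersection inside the space even when
    there are no rules.\<close>
  then have "closedin (full_shift G A) (\<Inter>(insert ?T {?C P g | W P g. (W, P) \<in> I \<and> g \<in> carrier G}))"
    by (intro closedin_Inter) auto
  moreover have "\<Inter>(insert ?T {?C P g | W P g. (W, P) \<in> I \<and> g \<in> carrier G}) = ?X"
    by auto
  moreover have "shift_act G k x \<in> ?X" if k: "k \<in> carrier G" and x: "x \<in> ?X" for k x
  proof -
    have "P (\<lambda>s. shift_act G k x (g \<otimes>\<^bsub>G\<^esub> s))" if "(W, P) \<in> I" "g \<in> carrier G" for W P g
    proof -
      have "P (\<lambda>s. x ((inv\<^bsub>G\<^esub> k \<otimes>\<^bsub>G\<^esub> g) \<otimes>\<^bsub>G\<^esub> s))" using x k that by auto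
      moreover have "shift_act G k x (g \<otimes>\<^bsub>G\<^esub> s) = x ((inv\<^bsub>G\<^esub> k \<otimes>\<^bsub>G\<^esub> g) \<otimes>\<^bsub>G\<^esub> s)" if "s \<in> W" for s
        using that W[OF \<open>(W, P) \<in> I\<close>] k \<open>g \<in> carrier G\<close> by (auto simp: shift_act_def m_assoc)
      ultimately show ?thesis
        using P[OF that(1), of "\<lambda>s. shift_act G k x (g \<otimes>\<^bsub>G\<^esub> s)" "\<lambda>s. x ((inv\<^bsub>G\<^esub> k \<otimes>\<^bsub>G\<^esub> g) \<otimes>\<^bsub>G\<^esub> s)"] by simp
    qed
    moreover have "shift_act G k x \<in> ?T"
      using shift_act_closed[OF assms(1) k] x by blast
    ultimately show ?thesis by auto
  qed
  ultimately show ?thesis using assms(2) by (simp add: subshift_def)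
qed

lemma sft_local:
  assumes G: "Group.group G" "finite A"
    and W: "finite W" "W \<subseteq> carrier G"
    and P: "\<And>x x'. (\<And>s. s \<in> W \<Longrightarrow> x s = x' s) \<Longrightarrow> P x \<longleftrightarrow> P x'"
  shows "sft G A {x \<in> topspace (full_shift G A). \<forall>g\<in>carrier G. P (\<lambda>s. x (g \<otimes>\<^bsub>G\<^esub> s))}"
    (is "sft G A ?X")
proof -
  interpret Group.group G by (rule assms)
  let ?T = "topspace (full_shift G A)" and ?C = "{x \<in> topspace (full_shift G A). \<not> P x}"
  have "subshift G A {x \<in> ?T. \<forall>(W, P)\<in>{(W, P)}. \<forall>g\<in>carrier G. P (\<lambda>s. x (g \<otimes>\<^bsub>G\<^esub> s))}"
  proof (rule subshift_local[OF G])
    fix W' P' and x x' :: "'a \<Rightarrow> 'c"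
    assume "(W', P') \<in> {(W, P)}" "\<And>s. s \<in> W' \<Longrightarrow> x s = x' s"
    then show "P' x \<longleftrightarrow> P' x'" using P[of x x'] by blast
  qed (use W in simp)
  then have "subshift G A ?X" by simp
  moreover have "openin (full_shift G A) ?C"
    using W by (rule openin_full_shift_local) (use P in blast)
  moreover have "closedin (full_shift G A) ?C"
    using W by (rule closedin_full_shift_local) (use P in blast)
  moreover have "?X = {x \<in> ?T. \<forall>g\<in>carrier G. shift_act G g x \<notin> ?C}"
  proof -
    have "P (shift_act G g x) \<longleftrightarrow> P (\<lambda>s. x (inv\<^bsub>G\<^esub> g \<otimes>\<^bsub>G\<^esub> s))" for g x
      using W by (intro P) (auto simp: shift_act_def)
    then have "shift_act G g x \<notin> ?C \<longleftrightarrow> P (\<lambda>s. x (inv\<^bsub>G\<^esub> g \<otimes>\<^bsub>G\<^esub> s))" if "x \<in> ?T" "g \<in> carrier G" for x g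
      using that shift_act_closed[OF G(1) that(2,1)] by simp
    \<comment> \<open>Shifting by \<open>g\<close> reads the rule at the inverse of
      \<open>g\<close>; over the whole group this is the same condition.\<close>
    moreover have "(\<forall>g\<in>carrier G. P (\<lambda>s. x (g \<otimes>\<^bsub>G\<^esub> s)))
        \<longleftrightarrow> (\<forall>g\<in>carrier G. P (\<lambda>s. x (inv\<^bsub>G\<^esub> g \<otimes>\<^bsub>G\<^esub> s)))" for x
      by (metis inv_closed inv_inv)
    ultimately show ?thesis by blast
  qed
  ultimately show ?thesis unfolding sft_def by blast
qed

lemma continuous_map_recoding:
  assumes "F \<in> A \<rightarrow> B"
  shows "continuous_map (full_shift G A) (full_shift G B) (\<lambda>x. \<lambda>g\<in>carrier G. F (x g))"
proof -
  have "continuous_map (full_shift G A) (discrete_topology B) (\<lambda>x. F (x g))" if "g \<in> carrier G" for g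
  proof -
    have 1: "continuous_map (full_shift G A) (discrete_topology A) (\<lambda>x. x g)"
      using that unfolding full_shift_def by (rule continuous_map_product_projection)
    have 2: "continuous_map (discrete_topology A) (discrete_topology B) F"
      using assms by simp
    from continuous_map_compose[OF 1 2] show ?thesis by (simp add: o_def)
  qed
  then show ?thesis
    unfolding full_shift_def[of G B] by (auto simp: continuous_map_componentwise)
qed

text \<open>Density of all orbits suffices: a closed set that misses \<open>y'\<close> misses a
  cylinder around it, whereas the orbit of any \<open>z\<close> in the invariant set
  \<open>Z\<close> enters that cylinder.\<close>

lemma minimal_subshiftI:
  assumes "subshift G A Y" "Y \<noteq> {}"
    and orbit: "\<And>y y' E. y \<in> Y \<Longrightarrow> y' \<in> Y \<Longrightarrow> finite E \<Longrightarrow> E \<subseteq> carrier G \<Longrightarrow>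
      \<exists>g\<in>carrier G. \<forall>h\<in>E. shift_act G g y h = y' h"
  shows "minimal_subshift G A Y"
  unfolding minimal_subshift_def
proof (intro conjI allI impI assms(1,2), elim conjE)
  fix Z assume Z: "subshift G A Z" "Z \<subseteq> Y" "Z \<noteq> {}"
  have YT: "Y \<subseteq> topspace (full_shift G A)"
    using assms(1) closedin_subset by (auto simp: subshift_def)
  show "Z = Y"
  proof (rule ccontr)
    assume "Z \<noteq> Y"
    then obtain y' z where y': "y' \<in> Y" "y' \<notin> Z" and z: "z \<in> Z" using Z by blast
    have "openin (full_shift G A) (topspace (full_shift G A) - Z)"
      using Z by (auto simp: subshift_def)
    moreover have "y' \<in> topspace (full_shift G A) - Z" using y' YT by auto
    ultimately have "\<exists>U. finite {i \<in> carrier G. U i \<noteq> A} \<and> y' \<in> Pi\<^sub>E (carrier G) U \<and>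
        Pi\<^sub>E (carrier G) U \<subseteq> topspace (full_shift G A) - Z"
      unfolding full_shift_def openin_product_topology_alt topspace_product_topology
        topspace_discrete_topology by blast
    then obtain U where U: "finite {i \<in> carrier G. U i \<noteq> A}"
      "y' \<in> Pi\<^sub>E (carrier G) U" "Pi\<^sub>E (carrier G) U \<subseteq> topspace (full_shift G A) - Z"
      by blast
    obtain g where g: "g \<in> carrier G" "\<forall>h\<in>{i \<in> carrier G. U i \<noteq> A}. shift_act G g z h = y' h"
      using orbit[OF _ y'(1) U(1)] z Z by blast
    have gz: "shift_act G g z \<in> Z" using Z g z by (auto simp: subshift_def)
    then have "shift_act G g z \<in> carrier G \<rightarrow>\<^sub>E A"
      using Z YT by (auto simp: topspace_full_shift)
    then have "shift_act G g z \<in> Pi\<^sub>E (carrier G) U"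
      using g(2) U(2) by (force simp: PiE_iff)
    with U(3) gz show False by auto
  qed
qed

section \<open>The semidirect product\<close>

type_synonym elt = "(nat word \<times> nat word) \<times> nat word"

locale twisted =
  fixes p :: "nat word \<Rightarrow> nat word" and \<alpha> :: "nat word \<Rightarrow> nat word \<Rightarrow> nat word"
  assumes p_hom: "p \<in> hom (free_group {..<4 :: nat}) (free_group {..<3 :: nat})"
    and p_id: "\<And>w. w \<in> carrier (free_group {..<3}) \<Longrightarrow> p w = w" and p_3: "p [(3, True)] = []"
    and \<alpha>_hom: "\<And>f. f \<in> carrier (free_group UNIV) \<Longrightarrow> \<alpha> f \<in> hom (free_group {..<4}) (free_group {..<4})"
    and \<alpha>_mult: "\<And>f g u. \<lbrakk>f \<in> carrier (free_group UNIV); g \<in> carrier (free_group UNIV); u \<in> carrier (free_group {..<4})\<rbrakk>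
      \<Longrightarrow> \<alpha> (f \<otimes>\<^bsub>free_group UNIV\<^esub> g) u = \<alpha> f (\<alpha> g u)"
    and \<alpha>_one: "\<And>u. u \<in> carrier (free_group {..<4}) \<Longrightarrow> \<alpha> [] u = u"
    and \<alpha>_id: "\<And>f w. \<lbrakk>f \<in> carrier (free_group UNIV); w \<in> carrier (free_group {..<3})\<rbrakk> \<Longrightarrow> \<alpha> f w = w"
    and \<alpha>_3: "\<And>f. \<lbrakk>f \<in> carrier (free_group UNIV); f \<noteq> []\<rbrakk> \<Longrightarrow> p (\<alpha> f [(3, True)]) \<noteq> []"
begin

abbreviation "F2 \<equiv> free_group {..<2 :: nat}"
abbreviation "F3 \<equiv> free_group {..<3 :: nat}"
abbreviation "F4 \<equiv> free_group {..<4 :: nat}"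
abbreviation "Finf \<equiv> free_group (UNIV :: nat set)"

sublocale F2: Group.group F2 by (rule group_free_group)
sublocale F3: Group.group F3 by (rule group_free_group)
sublocale F4: Group.group F4 by (rule group_free_group)
sublocale Finf: Group.group Finf by (rule group_free_group)

text \<open>Restricted to the carrier because the elements of \<open>AutoGroup\<close> are
  extensional maps.\<close>

definition \<theta> :: "nat word \<Rightarrow> nat word \<times> nat word \<Rightarrow> nat word \<times> nat word" where
  "\<theta> f = (\<lambda>(u, v)\<in>carrier F4 \<times> carrier F2. (\<alpha> f u, v))"

definition "G = semidirect_product (F4 \<times>\<times> F2) Finf \<theta>"

lemma \<alpha>_closed: "f \<in> carrier Finf \<Longrightarrow> u \<in> carrier F4 \<Longrightarrow> \<alpha> f u \<in> carrier F4"
  by (rule hom_in_carrier[OF \<alpha>_hom])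

lemma \<alpha>_inv:
  assumes "f \<in> carrier Finf" "u \<in> carrier F4"
  shows "\<alpha> (inv\<^bsub>Finf\<^esub> f) (\<alpha> f u) = u" "\<alpha> f (\<alpha> (inv\<^bsub>Finf\<^esub> f) u) = u"
  using assms \<alpha>_mult[of "inv\<^bsub>Finf\<^esub> f" f u] \<alpha>_mult[of f "inv\<^bsub>Finf\<^esub> f" u] \<alpha>_one
  by (simp_all only: Finf.l_inv Finf.r_inv Finf.inv_closed free_one)

lemma \<theta>_hom: "\<theta> \<in> hom Finf (AutoGroup (F4 \<times>\<times> F2))"
proof (rule homI)
  fix f assume f: "f \<in> carrier Finf"
  have "\<theta> f \<in> hom (F4 \<times>\<times> F2) (F4 \<times>\<times> F2)"
    using f by (intro homI) (auto simp: \<theta>_def \<alpha>_closed hom_mult[OF \<alpha>_hom] simp del: free_mult)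
  moreover have "bij_betw (\<theta> f) (carrier F4 \<times> carrier F2) (carrier F4 \<times> carrier F2)"
    using f by (intro bij_betwI[of _ _ _ "\<theta> (inv\<^bsub>Finf\<^esub> f)"])
      (auto simp: \<theta>_def \<alpha>_closed \<alpha>_inv simp del: free_inv)
  ultimately show "\<theta> f \<in> carrier (AutoGroup (F4 \<times>\<times> F2))"
    by (simp add: AutoGroup_def auto_def Bij_def \<theta>_def)
  then have "\<theta> f \<in> Bij (carrier F4 \<times> carrier F2)"
    by (simp add: AutoGroup_def auto_def)
  note Bij = this
  show "\<theta> (f \<otimes>\<^bsub>Finf\<^esub> g) = \<theta> f \<otimes>\<^bsub>AutoGroup (F4 \<times>\<times> F2)\<^esub> \<theta> g" if g: "g \<in> carrier Finf" for g
  proof -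
    have "bij_betw (\<theta> g) (carrier F4 \<times> carrier F2) (carrier F4 \<times> carrier F2)"
      using g by (intro bij_betwI[of _ _ _ "\<theta> (inv\<^bsub>Finf\<^esub> g)"])
        (auto simp: \<theta>_def \<alpha>_closed \<alpha>_inv simp del: free_inv)
    then have "\<theta> g \<in> Bij (carrier F4 \<times> carrier F2)" by (simp add: Bij_def \<theta>_def)
    then have "\<theta> f \<otimes>\<^bsub>AutoGroup (F4 \<times>\<times> F2)\<^esub> \<theta> g = compose (carrier F4 \<times> carrier F2) (\<theta> f) (\<theta> g)"
      using Bij by (simp add: AutoGroup_def BijGroup_def)
    also have "\<dots> = \<theta> (f \<otimes>\<^bsub>Finf\<^esub> g)"
      using f g by (auto simp: fun_eq_iff \<theta>_def compose_def \<alpha>_closed \<alpha>_mult simp del: free_mult)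
    finally show ?thesis by simp
  qed
qed

lemma group_G: "Group.group G"
  unfolding G_def by (intro group_semidirect_product DirProd_group group_free_group \<theta>_hom)

sublocale G: Group.group G by (rule group_G)

lemma carrier_G: "((u, v), f) \<in> carrier G \<longleftrightarrow> u \<in> carrier F4 \<and> v \<in> carrier F2 \<and> f \<in> carrier Finf"
  by (auto simp: G_def semidirect_product_def)

lemma G_one: "\<one>\<^bsub>G\<^esub> = (([], []), [])"
  by (simp add: G_def semidirect_product_def)

lemma G_mult:
  assumes "u' \<in> carrier F4" "v' \<in> carrier F2"
  shows "((u, v), f) \<otimes>\<^bsub>G\<^esub> ((u', v'), f') = ((u \<otimes>\<^bsub>F4\<^esub> \<alpha> f u', v \<otimes>\<^bsub>F2\<^esub> v'), f \<otimes>\<^bsub>Finf\<^esub> f')"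
  using assms by (simp add: G_def semidirect_product_def \<theta>_def)

section \<open>The factors F4 and F2 inside G\<close>

definition iU :: "nat word \<Rightarrow> elt" where "iU u = ((u, []), [])"
definition iV :: "nat word \<Rightarrow> elt" where "iV v = (([], v), [])"

lemma Nil_carrier [simp]: "[] \<in> carrier (free_group S)"
  by (simp add: free_carrier)

lemma iU_closed [simp]: "iU u \<in> carrier G \<longleftrightarrow> u \<in> carrier F4"
  by (simp add: iU_def carrier_G)

lemma iV_closed [simp]: "iV v \<in> carrier G \<longleftrightarrow> v \<in> carrier F2"
  by (simp add: iV_def carrier_G)

lemma mult_iU:
  assumes "w \<in> carrier F4" "v \<in> carrier F2" "f \<in> carrier Finf"
  shows "((u, v), f) \<otimes>\<^bsub>G\<^esub> iU w = ((u \<otimes>\<^bsub>F4\<^esub> \<alpha> f w, v), f)"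
  using assms F2.r_one[of v] Finf.r_one[of f] by (simp add: iU_def G_mult)

lemma \<alpha>_Nil: "f \<in> carrier Finf \<Longrightarrow> \<alpha> f [] = []"
  by (rule \<alpha>_id) auto

lemma mult_iV:
  assumes "u \<in> carrier F4" "t \<in> carrier F2" "f \<in> carrier Finf"
  shows "((u, v), f) \<otimes>\<^bsub>G\<^esub> iV t = ((u, v \<otimes>\<^bsub>F2\<^esub> t), f)"
  using assms F4.r_one[of u] Finf.r_one[of f] by (simp add: iV_def G_mult \<alpha>_Nil)

lemma iU_mult: "u \<in> carrier F4 \<Longrightarrow> w \<in> carrier F4 \<Longrightarrow> iU u \<otimes>\<^bsub>G\<^esub> iU w = iU (u \<otimes>\<^bsub>F4\<^esub> w)"
  using mult_iU[of w "[]" "[]" u] by (simp add: iU_def \<alpha>_one)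

lemma iV_mult: "v \<in> carrier F2 \<Longrightarrow> t \<in> carrier F2 \<Longrightarrow> iV v \<otimes>\<^bsub>G\<^esub> iV t = iV (v \<otimes>\<^bsub>F2\<^esub> t)"
  using mult_iV[of "[]" t "[]" v] by (simp add: iV_def)

lemma iU_iV:
  assumes "u \<in> carrier F4" "v \<in> carrier F2"
  shows "iU u \<otimes>\<^bsub>G\<^esub> iV v = ((u, v), [])" "iV v \<otimes>\<^bsub>G\<^esub> iU u = ((u, v), [])"
  using assms mult_iU[of u v "[]" "[]"] mult_iV[of u v "[]" "[]"] by (simp_all add: iU_def iV_def \<alpha>_one)

lemma iU_Nil: "iU [] = \<one>\<^bsub>G\<^esub>" and iV_Nil: "iV [] = \<one>\<^bsub>G\<^esub>"
  by (simp_all add: iU_def iV_def G_one)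

lemma shift_iU:
  assumes "g \<in> carrier G" "u \<in> carrier F4" "w \<in> carrier F4"
  shows "(g \<otimes>\<^bsub>G\<^esub> iU u) \<otimes>\<^bsub>G\<^esub> iU w = g \<otimes>\<^bsub>G\<^esub> iU (u \<otimes>\<^bsub>F4\<^esub> w)"
  using assms by (simp add: G.m_assoc iU_mult del: free_mult)

lemma shift_swap:
  assumes "g \<in> carrier G" "u \<in> carrier F4" "v \<in> carrier F2"
  shows "(g \<otimes>\<^bsub>G\<^esub> iV v) \<otimes>\<^bsub>G\<^esub> iU u = (g \<otimes>\<^bsub>G\<^esub> iU u) \<otimes>\<^bsub>G\<^esub> iV v"
  using assms by (simp add: G.m_assoc iU_iV)

text \<open>In the coset of \<open>f\<close> a right step by \<open>iU w\<close> multiplies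
  \<open>u\<close> by \<open>\<alpha> f w\<close>. Hence the coordinate \<open>u\<close> is reached
  from the base point of the coset along the untwisted word \<open>\<alpha> f^-1 u\<close>.\<close>

lemma coset_decomposition:
  assumes "u \<in> carrier F4" "v \<in> carrier F2" "f \<in> carrier Finf"
  shows "((u, v), f) = ((([], []), f) \<otimes>\<^bsub>G\<^esub> iU (\<alpha> (inv\<^bsub>Finf\<^esub> f) u)) \<otimes>\<^bsub>G\<^esub> iV v"
proof -
  have "\<alpha> (inv\<^bsub>Finf\<^esub> f) u \<in> carrier F4" using assms by (intro \<alpha>_closed Finf.inv_closed)
  then show ?thesis
    using assms by (subst mult_iU) (simp_all add: mult_iV \<alpha>_inv del: free_inv)
qed

text \<open>If every step by a letter \<open>l\<close> multiplies the word \<open>r\<close> by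
  \<open>l^-1\<close>, induction from the right extends this to \<open>w\<close>. The domain
  \<open>D\<close> is kept general because \<open>ray\<close> needs all of \<open>G\<close> and
  \<open>stored\<close> only the cells in \<open>base\<close>.\<close>

lemma act_along_word:
  fixes r :: "elt \<Rightarrow> nat \<Rightarrow> nat \<times> bool"
  assumes D: "D \<subseteq> carrier G" "\<And>k l. k \<in> D \<Longrightarrow> fst l < 4 \<Longrightarrow> k \<otimes>\<^bsub>G\<^esub> iU [l] \<in> D"
    and r: "\<And>k l. k \<in> D \<Longrightarrow> fst l < 4 \<Longrightarrow> r (k \<otimes>\<^bsub>G\<^esub> iU [l]) = lact (inv_letter l) (r k)"
    and k: "k \<in> D"
  shows "w \<in> carrier F4 \<Longrightarrow> k \<otimes>\<^bsub>G\<^esub> iU w \<in> D \<and> r (k \<otimes>\<^bsub>G\<^esub> iU w) = act (inv_word w) (r k)"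
proof (induction w rule: rev_induct)
  case Nil
  then show ?case using k D(1) by (auto simp: iU_Nil)
next
  case (snoc l w)
  then have w: "w \<in> carrier F4" "reduced_word (w @ [l])" "fst l < 4"
    by (auto simp: free_carrier reduced_append)
  have "(k \<otimes>\<^bsub>G\<^esub> iU w) \<otimes>\<^bsub>G\<^esub> iU [l] = k \<otimes>\<^bsub>G\<^esub> iU (w @ [l])"
    using shift_iU[of k w "[l]"] w k D(1) by (auto simp: foldr_lmult_append simp del: foldr.simps)
  then show ?case
    using D(2)[of "k \<otimes>\<^bsub>G\<^esub> iU w" l] r[of "k \<otimes>\<^bsub>G\<^esub> iU w" l] snoc.IH[OF w(1)] w(3) by simp
qed

section \<open>The minimal subshift\<close>

abbreviation enc :: "nat \<times> bool \<Rightarrow> nat" where "enc \<equiv> to_nat"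
abbreviation dec :: "nat \<Rightarrow> nat \<times> bool" where "dec \<equiv> from_nat"

definition B :: "nat set" where "B = enc ` {l. fst l < 3}"

lemma dec_B: "b \<in> B \<Longrightarrow> fst (dec b) < 3" "b \<in> B \<Longrightarrow> enc (dec b) = b"
  by (auto simp: B_def)

lemma finite_letters: "finite {l :: nat \<times> bool. fst l < k}"
proof -
  have "{l :: nat \<times> bool. fst l < k} = {..<k} \<times> UNIV" by auto
  then show ?thesis by simp
qed

lemma finite_B: "finite B"
  unfolding B_def by (intro finite_imageI finite_letters)

text \<open>
  By the second clause the letters are directions pointing to an end of the tree of the free group
  on \<open>a, b, c\<close>; by the third one they are invariant under the normal closure of \<open>d\<close>.
\<close>

definition Y :: "(elt \<Rightarrow> nat) set" where
  "Y = {y \<in> carrier G \<rightarrow>\<^sub>E B. \<forall>g\<in>carrier G.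
      (\<forall>v\<in>carrier F2. y (g \<otimes>\<^bsub>G\<^esub> iV v) = y g) \<and>
      (\<forall>s. fst s < 3 \<longrightarrow> (dec (y (g \<otimes>\<^bsub>G\<^esub> iU [s])) = inv_letter s \<longleftrightarrow> dec (y g) \<noteq> s)) \<and>
      (\<forall>l. \<forall>w\<in>carrier F4. fst l = 3 \<longrightarrow> y (g \<otimes>\<^bsub>G\<^esub> iU ([l] \<otimes>\<^bsub>F4\<^esub> w)) = y (g \<otimes>\<^bsub>G\<^esub> iU w))}"

text \<open>The rules indexed by \<open>w\<close> have no common finite window, so this argument
  yields a closed invariant set but not finite type.\<close>

lemma subshift_Y: "subshift G B Y"
proof -
  define I where "I =
    {({\<one>\<^bsub>G\<^esub>, iV v}, \<lambda>y :: _ \<Rightarrow> nat. y (iV v) = y \<one>\<^bsub>G\<^esub>) | v. v \<in> carrier F2} \<union>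
    {({\<one>\<^bsub>G\<^esub>, iU [s]}, \<lambda>y. dec (y (iU [s])) = inv_letter s \<longleftrightarrow> dec (y \<one>\<^bsub>G\<^esub>) \<noteq> s) | s. fst s < 3} \<union>
    {({iU ([l] \<otimes>\<^bsub>F4\<^esub> w), iU w}, \<lambda>y. y (iU ([l] \<otimes>\<^bsub>F4\<^esub> w)) = y (iU w)) | l w. fst l = 3 \<and> w \<in> carrier F4}"
  have lw: "[l] \<otimes>\<^bsub>F4\<^esub> w \<in> carrier F4" if "fst l = 3" "w \<in> carrier F4" for l w
    using that by (intro F4.m_closed) auto
  have "subshift G B {y \<in> topspace (full_shift G B).
      \<forall>(W, P)\<in>I. \<forall>g\<in>carrier G. P (\<lambda>s. y (g \<otimes>\<^bsub>G\<^esub> s))}"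
  proof (rule subshift_local[OF group_G finite_B])
    show "finite W \<and> W \<subseteq> carrier G" if "(W, P) \<in> I" for W P
      using that lw unfolding I_def by (auto simp del: free_mult)
    show "P x \<longleftrightarrow> P x'" if "(W, P) \<in> I" "\<And>s. s \<in> W \<Longrightarrow> x s = x' s" for W P and x x' :: "_ \<Rightarrow> nat"
      using that unfolding I_def by (elim UnE CollectE exE conjE Pair_inject) (simp_all del: free_mult)
  qed
  also have "{y \<in> topspace (full_shift G B). \<forall>(W, P)\<in>I. \<forall>g\<in>carrier G. P (\<lambda>s. y (g \<otimes>\<^bsub>G\<^esub> s))} = Y"
  proof -
    have "(\<forall>(W, P)\<in>I. \<forall>g\<in>carrier G. P (\<lambda>s. y (g \<otimes>\<^bsub>G\<^esub> s))) \<longleftrightarrow> (\<forall>g\<in>carrier G.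
      (\<forall>v\<in>carrier F2. y (g \<otimes>\<^bsub>G\<^esub> iV v) = y g) \<and>
      (\<forall>s. fst s < 3 \<longrightarrow> (dec (y (g \<otimes>\<^bsub>G\<^esub> iU [s])) = inv_letter s \<longleftrightarrow> dec (y g) \<noteq> s)) \<and>
      (\<forall>l. \<forall>w\<in>carrier F4. fst l = 3 \<longrightarrow> y (g \<otimes>\<^bsub>G\<^esub> iU ([l] \<otimes>\<^bsub>F4\<^esub> w)) = y (g \<otimes>\<^bsub>G\<^esub> iU w)))" for y
      unfolding I_def ball_Un ball_family ball_family2
      by (simp del: free_mult add: G.r_one cong: ball_cong) blast
    then show ?thesis by (simp add: Y_def topspace_full_shift)
  qed
  finally show ?thesis .
qed

section \<open>From points of Y to boundary points\<close>

text \<open>The infinite word spelled by following the directions from \<open>g\<close>: the end at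
  which \<open>y\<close> points, as seen from \<open>g\<close>.\<close>

primrec ray :: "(elt \<Rightarrow> nat) \<Rightarrow> nat \<Rightarrow> elt \<Rightarrow> nat \<times> bool" where
  "ray y 0 g = dec (y g)"
| "ray y (Suc n) g = ray y n (g \<otimes>\<^bsub>G\<^esub> iU [dec (y g)])"

context
  fixes y assumes y: "y \<in> Y"
begin

lemma Y_letter: "g \<in> carrier G \<Longrightarrow> fst (dec (y g)) < 3"
  using y by (auto simp: Y_def PiE_iff dec_B)

lemma Y_V: "g \<in> carrier G \<Longrightarrow> v \<in> carrier F2 \<Longrightarrow> y (g \<otimes>\<^bsub>G\<^esub> iV v) = y g"
  using y by (auto simp: Y_def)

lemma Y_step: "g \<in> carrier G \<Longrightarrow> fst s < 3 \<Longrightarrow> dec (y (g \<otimes>\<^bsub>G\<^esub> iU [s])) = inv_letter s \<longleftrightarrow> dec (y g) \<noteq> s"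
  using y unfolding Y_def by blast

lemma Y_kernel: "g \<in> carrier G \<Longrightarrow> w \<in> carrier F4 \<Longrightarrow> fst l = 3
    \<Longrightarrow> y (g \<otimes>\<^bsub>G\<^esub> iU ([l] \<otimes>\<^bsub>F4\<^esub> w)) = y (g \<otimes>\<^bsub>G\<^esub> iU w)"
  using y unfolding Y_def by blast

lemma next_closed: "g \<in> carrier G \<Longrightarrow> g \<otimes>\<^bsub>G\<^esub> iU [dec (y g)] \<in> carrier G"
  using Y_letter[of g] by (intro G.m_closed) auto

text \<open>The second clause of \<open>Y\<close>, taken with \<open>s\<close> the direction shown
  at \<open>g\<close>, forbids turning back at the next step.\<close>

lemma ray_bdry: "g \<in> carrier G \<Longrightarrow> (\<lambda>n. ray y n g) \<in> bdry"
proof -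
  have "fst (ray y n g) < 3 \<and> ray y (Suc n) g \<noteq> inv_letter (ray y n g)" if "g \<in> carrier G" for n g
    using that
  proof (induction n arbitrary: g)
    case 0
    then show ?case using Y_letter[of g] Y_step[of g "dec (y g)"] by simp
  next
    case (Suc n)
    then show ?case using next_closed by simp
  qed
  then show "g \<in> carrier G \<Longrightarrow> (\<lambda>n. ray y n g) \<in> bdry" unfolding bdry_def by blast
qed

lemma ray_kernel:
  assumes "fst l = 3" "g \<in> carrier G"
  shows "ray y n (g \<otimes>\<^bsub>G\<^esub> iU [l]) = ray y n g"
proof -
  \<comment> \<open>Generalised over \<open>w\<close> because each step of the ray leads from
    \<open>g l w\<close> to \<open>g l w s\<close>.\<close>
  have "ray y n (g \<otimes>\<^bsub>G\<^esub> iU ([l] \<otimes>\<^bsub>F4\<^esub> w)) = ray y n (g \<otimes>\<^bsub>G\<^esub> iU w)" if "w \<in> carrier F4" for w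
    using that
  proof (induction n arbitrary: w)
    case 0
    then show ?case using Y_kernel[OF assms(2) 0 assms(1)] by simp
  next
    case (Suc n)
    have l: "[l] \<in> carrier F4" using assms by simp
    define s where "s = dec (y (g \<otimes>\<^bsub>G\<^esub> iU w))"
    have s: "[s] \<in> carrier F4" using Y_letter[of "g \<otimes>\<^bsub>G\<^esub> iU w"] Suc.prems assms by (simp add: s_def)
    have "(g \<otimes>\<^bsub>G\<^esub> iU ([l] \<otimes>\<^bsub>F4\<^esub> w)) \<otimes>\<^bsub>G\<^esub> iU [s] = g \<otimes>\<^bsub>G\<^esub> iU ([l] \<otimes>\<^bsub>F4\<^esub> (w \<otimes>\<^bsub>F4\<^esub> [s]))"
      using shift_iU[OF assms(2) F4.m_closed[OF l Suc.prems] s] F4.m_assoc[OF l Suc.prems s] by simp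
    moreover have "(g \<otimes>\<^bsub>G\<^esub> iU w) \<otimes>\<^bsub>G\<^esub> iU [s] = g \<otimes>\<^bsub>G\<^esub> iU (w \<otimes>\<^bsub>F4\<^esub> [s])"
      using shift_iU[OF assms(2) Suc.prems s] .
    ultimately show ?case
      using Suc.IH[OF F4.m_closed[OF Suc.prems s]] Y_kernel[OF assms(2) Suc.prems assms(1)]
      by (simp add: s_def del: free_mult)
  qed
  from this[of "[]"] show ?thesis using assms by (simp add: iU_Nil)
qed

text \<open>A step by \<open>d\<close> or its inverse changes nothing, by \<open>ray_kernel\<close>.
  A step in the direction shown drops the first letter. After any other step the direction points
  back to \<open>g\<close>, which prepends \<open>l^-1\<close>.\<close>

lemma ray_step:
  assumes "fst l < 4" "g \<in> carrier G"
  shows "(\<lambda>n. ray y n (g \<otimes>\<^bsub>G\<^esub> iU [l])) = lact (inv_letter l) (\<lambda>n. ray y n g)"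
proof (cases "fst l = 3")
  case True
  then show ?thesis using ray_kernel[OF True assms(2)] by (simp add: lact_def)
next
  case False
  then have l: "fst l < 3" using assms by simp
  show ?thesis
  proof (cases "dec (y g) = l")
    case True
    then show ?thesis using l by (auto simp: lact_def)
  next
    case False
    have g: "g \<otimes>\<^bsub>G\<^esub> iU [l] \<in> carrier G" using assms by (intro G.m_closed) auto
    have next': "dec (y (g \<otimes>\<^bsub>G\<^esub> iU [l])) = inv_letter l" using Y_step[OF assms(2) l] False by simp
    have "(g \<otimes>\<^bsub>G\<^esub> iU [l]) \<otimes>\<^bsub>G\<^esub> iU [inv_letter l] = g"
      using shift_iU[of g "[l]" "[inv_letter l]"] assms by (simp add: iU_Nil)
    then have "ray y n (g \<otimes>\<^bsub>G\<^esub> iU [l]) = case_nat (inv_letter l) (\<lambda>n. ray y n g) n" for n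
      using next' by (cases n) simp_all
    then show ?thesis using l False by (auto simp: lact_def)
  qed
qed

lemma ray_act:
  assumes "g \<in> carrier G" "w \<in> carrier F4"
  shows "(\<lambda>n. ray y n (g \<otimes>\<^bsub>G\<^esub> iU w)) = act (inv_word w) (\<lambda>n. ray y n g)"
  using act_along_word[of "carrier G" "\<lambda>g n. ray y n g" g w] ray_step assms by auto

text \<open>A point of \<open>Y\<close> carries no more information than one boundary point for each
  \<open>f\<close>: its letters do not depend on \<open>v\<close>, and the ray at the base point of
  a coset fixes all others in that coset.\<close>

lemma Y_eq:
  assumes "u \<in> carrier F4" "v \<in> carrier F2" "f \<in> carrier Finf"
  shows "y ((u, v), f) = enc (act (inv_word (\<alpha> (inv\<^bsub>Finf\<^esub> f) u)) (\<lambda>n. ray y n (([], []), f)) 0)"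
proof -
  let ?u = "\<alpha> (inv\<^bsub>Finf\<^esub> f) u"
  have f: "(([], []), f) \<in> carrier G" using assms by (simp add: carrier_G)
  have u: "?u \<in> carrier F4" using assms by (intro \<alpha>_closed Finf.inv_closed)
  have g: "(([], []), f) \<otimes>\<^bsub>G\<^esub> iU ?u \<in> carrier G" using f u by (intro G.m_closed) simp_all
  have "y ((u, v), f) = y ((([], []), f) \<otimes>\<^bsub>G\<^esub> iU ?u)"
    using Y_V[OF g assms(2)] coset_decomposition[OF assms] by simp
  moreover have "y ((([], []), f) \<otimes>\<^bsub>G\<^esub> iU ?u) \<in> B" using y g by (auto simp: Y_def)
  moreover have "dec (y ((([], []), f) \<otimes>\<^bsub>G\<^esub> iU ?u)) = act (inv_word ?u) (\<lambda>n. ray y n (([], []), f)) 0"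
    using fun_cong[OF ray_act[OF f u], of 0] by simp
  ultimately show ?thesis using dec_B(2) by metis
qed

end

section \<open>From boundary points to points of Y\<close>

text \<open>The converse of \<open>Y_eq\<close>. All conditions in \<open>Y\<close> compare cells of
  one coset, so the points \<open>\<xi> f\<close> may be chosen independently.\<close>

definition config :: "(nat word \<Rightarrow> nat \<Rightarrow> nat \<times> bool) \<Rightarrow> elt \<Rightarrow> nat" where
  "config \<xi> = (\<lambda>((u, v), f)\<in>carrier G. enc (act (inv_word (\<alpha> (inv\<^bsub>Finf\<^esub> f) u)) (\<xi> f) 0))"

lemma config_in_Y:
  assumes \<xi>: "\<And>f. f \<in> carrier Finf \<Longrightarrow> \<xi> f \<in> bdry"
  shows "config \<xi> \<in> Y"
proof -
  \<comment> \<open>\<open>\<eta> g\<close> is the whole word seen from \<open>g\<close>, of which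
    the configuration shows the first letter; the clauses of \<open>Y\<close> follow from its
    behaviour under right steps.\<close>
  define \<eta> where "\<eta> g = (case g of ((u, v), f) \<Rightarrow> act (inv_word (\<alpha> (inv\<^bsub>Finf\<^esub> f) u)) (\<xi> f))"
    for g :: elt
  have \<eta>: "\<eta> g \<in> bdry" if "g \<in> carrier G" for g
    using that \<xi> by (auto simp: \<eta>_def G_def semidirect_product_def intro: act_closed)
  have config: "config \<xi> g = enc (\<eta> g 0)" if "g \<in> carrier G" for g
    using that by (auto simp: config_def \<eta>_def split: prod.splits)
  have \<eta>_V: "\<eta> (g \<otimes>\<^bsub>G\<^esub> iV t) = \<eta> g" if "g \<in> carrier G" "t \<in> carrier F2" for g t
    using that by (cases g) (auto simp: carrier_G \<eta>_def mult_iV)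
  have \<eta>_U: "\<eta> (g \<otimes>\<^bsub>G\<^esub> iU w) = act (inv_word w) (\<eta> g)" if "g \<in> carrier G" "w \<in> carrier F4" for g w
  proof -
    obtain u v f where g: "g = ((u, v), f)" by (metis prod.exhaust)
    with that have c: "u \<in> carrier F4" "v \<in> carrier F2" "f \<in> carrier Finf" by (auto simp: carrier_G)
    let ?i = "inv\<^bsub>Finf\<^esub> f"
    have i: "?i \<in> carrier Finf" using c by (intro Finf.inv_closed)
    \<comment> \<open>This undoes the twist: a right step by \<open>w\<close> multiplies the
      untwisted word by \<open>w\<close> itself.\<close>
    have "\<alpha> ?i (u \<otimes>\<^bsub>F4\<^esub> \<alpha> f w) = \<alpha> ?i u \<otimes>\<^bsub>F4\<^esub> w"
      using hom_mult[OF \<alpha>_hom[OF i] c(1) \<alpha>_closed[OF c(3) that(2)]] \<alpha>_inv(1)[OF c(3) that(2)] by simp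
    moreover have "inv\<^bsub>F4\<^esub> (\<alpha> ?i u \<otimes>\<^bsub>F4\<^esub> w) = inv\<^bsub>F4\<^esub> w \<otimes>\<^bsub>F4\<^esub> inv\<^bsub>F4\<^esub> (\<alpha> ?i u)"
      using \<alpha>_closed[OF i c(1)] that(2) by (rule F4.inv_mult_group)
    ultimately have "inv_word (\<alpha> ?i (u \<otimes>\<^bsub>F4\<^esub> \<alpha> f w)) = foldr lmult (inv_word w) (inv_word (\<alpha> ?i u))"
      using \<alpha>_closed[OF i c(1)] that(2) F4.m_closed[OF \<alpha>_closed[OF i c(1)] that(2)] by (simp del: free_mult) simp
    then show ?thesis
      using c that(2) \<xi>[OF c(3)] by (simp add: g mult_iU \<eta>_def act_mult del: free_mult)
  qed
  have "config \<xi> \<in> carrier G \<rightarrow>\<^sub>E B"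
    using config \<eta> by (auto simp: B_def bdry_def config_def)
  moreover have "dec (config \<xi> (g \<otimes>\<^bsub>G\<^esub> iU [s])) = inv_letter s \<longleftrightarrow> dec (config \<xi> g) \<noteq> s"
    if "g \<in> carrier G" "fst s < 3" for g s
  proof -
    have "\<eta> (g \<otimes>\<^bsub>G\<^esub> iU [s]) = lact (inv_letter s) (\<eta> g)" "g \<otimes>\<^bsub>G\<^esub> iU [s] \<in> carrier G"
      using \<eta>_U[of g "[s]"] that by simp_all
    moreover have "\<eta> g (Suc 0) \<noteq> inv_letter (\<eta> g 0)" using \<eta>[OF that(1)] by (simp add: bdry_def)
    ultimately show ?thesis using that by (auto simp: config lact_def)
  qed
  moreover have "config \<xi> (g \<otimes>\<^bsub>G\<^esub> iU ([l] \<otimes>\<^bsub>F4\<^esub> w)) = config \<xi> (g \<otimes>\<^bsub>G\<^esub> iU w)"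
    if "g \<in> carrier G" "w \<in> carrier F4" "fst l = 3" for g w l
  proof -
    have l: "[l] \<in> carrier F4" using that by simp
    have "\<eta> (g \<otimes>\<^bsub>G\<^esub> iU ([l] \<otimes>\<^bsub>F4\<^esub> w)) = \<eta> ((g \<otimes>\<^bsub>G\<^esub> iU [l]) \<otimes>\<^bsub>G\<^esub> iU w)"
      using shift_iU[OF that(1) l that(2)] by simp
    also have "\<dots> = act (inv_word w) (\<eta> g)"
      using \<eta>_U[of "g \<otimes>\<^bsub>G\<^esub> iU [l]" w] \<eta>_U[of g "[l]"] that l by (simp add: lact_def)
    also have "\<dots> = \<eta> (g \<otimes>\<^bsub>G\<^esub> iU w)" using \<eta>_U that by simp
    finally show ?thesis using config F4.m_closed[OF l that(2)] that by (simp del: free_mult)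
  qed
  ultimately show ?thesis
    using config \<eta>_V by (auto simp: Y_def simp del: free_mult)
qed

text \<open>The \<open>k\<close>-th point has \<open>a a a ...\<close> on the coset of the generator
  \<open>k\<close> and \<open>b b b ...\<close> on all others.\<close>

lemma infinite_Y: "infinite Y"
proof -
  define \<xi> where "\<xi> k f = (\<lambda>n :: nat. (if f = [(k :: nat, True)] then 0 else 1 :: nat, True))" for k f
  have "\<xi> k f \<in> bdry" for k f by (simp add: \<xi>_def bdry_def inv_letter_def)
  then have "range (\<lambda>k. config (\<xi> k)) \<subseteq> Y" using config_in_Y by blast
  moreover have "inj (\<lambda>k. config (\<xi> k))"
  proof (rule injI)
    fix j k assume eq: "config (\<xi> j) = config (\<xi> k)"
    let ?g = "(([], []), [(j, True)]) :: elt"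
    have "?g \<in> carrier G" by (simp add: carrier_G)
    moreover have "\<alpha> (inv\<^bsub>Finf\<^esub> [(j, True)]) [] = []" by (intro \<alpha>_Nil Finf.inv_closed) simp
    ultimately have "config (\<xi> i) ?g = enc (\<xi> i [(j, True)] 0)" for i
      by (simp add: config_def)
    then have "\<xi> j [(j, True)] 0 = \<xi> k [(j, True)] 0" using eq by (metis from_nat_to_nat)
    then show "j = k" by (simp add: \<xi>_def split: if_splits)
  qed
  ultimately show ?thesis using finite_subset range_inj_infinite by blast
qed

section \<open>Minimality of Y\<close>

text \<open>\<open>\<alpha> i^-1\<close> after \<open>\<alpha> j\<close> is
  \<open>\<alpha> (i^-1 j)\<close>. For \<open>i = j\<close> it fixes \<open>d\<close>, which
  \<open>p\<close> kills; otherwise \<open>i^-1 j\<close> is nontrivial and the image of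
  \<open>d\<close> survives \<open>p\<close> by \<open>\<alpha>_3\<close>.\<close>

lemma separated:
  assumes "I \<subseteq> carrier Finf"
  shows "separated_retractions I (\<lambda>f w. p (\<alpha> (inv\<^bsub>Finf\<^esub> f) w)) (\<lambda>f. \<alpha> f [(3, True)])"
proof
  have d: "[(3, True)] \<in> carrier F4" by simp
  fix j assume "j \<in> I"
  then have j: "j \<in> carrier Finf" "inv\<^bsub>Finf\<^esub> j \<in> carrier Finf"
    using assms by (auto intro: Finf.inv_closed simp del: free_inv)
  show "(\<lambda>w. p (\<alpha> (inv\<^bsub>Finf\<^esub> j) w)) \<in> hom F4 F3"
    using hom_mult[OF \<alpha>_hom[OF j(2)]] hom_mult[OF p_hom] \<alpha>_closed[OF j(2)] hom_in_carrier[OF p_hom]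
    by (intro homI) (simp_all del: free_mult free_inv)
  show "p (\<alpha> (inv\<^bsub>Finf\<^esub> j) w) = w" if "w \<in> carrier F3" for w
    using \<alpha>_id[OF j(2) that] p_id[OF that] by simp
  show "\<alpha> j [(3, True)] \<in> carrier F4" by (rule \<alpha>_closed[OF j(1) d])
  show "p (\<alpha> (inv\<^bsub>Finf\<^esub> j) (\<alpha> j [(3, True)])) = []"
    using \<alpha>_inv[OF j(1) d] p_3 by simp
  fix i assume i: "i \<in> I" "i \<noteq> j"
  then have i': "i \<in> carrier Finf" "inv\<^bsub>Finf\<^esub> i \<in> carrier Finf"
    using assms by (auto intro: Finf.inv_closed simp del: free_inv)
  have "inv\<^bsub>Finf\<^esub> i \<otimes>\<^bsub>Finf\<^esub> j \<noteq> \<one>\<^bsub>Finf\<^esub>"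
    using i(2) i' j by (metis Finf.inv_equality Finf.inv_inv)
  then show "p (\<alpha> (inv\<^bsub>Finf\<^esub> i) (\<alpha> j [(3, True)])) \<noteq> []"
    using \<alpha>_3[of "inv\<^bsub>Finf\<^esub> i \<otimes>\<^bsub>Finf\<^esub> j"] \<alpha>_mult[OF i'(2) j(1) d] Finf.m_closed[OF i'(2) j(1)] by simp
qed

text \<open>\<open>p\<close> fixes the first three generators and kills \<open>d\<close>, which acts
  trivially under \<open>lact\<close>.\<close>

lemma act_p:
  assumes "w \<in> carrier F4" "\<xi> \<in> bdry"
  shows "act (p w) \<xi> = act w \<xi>"
  using assms(1)
proof (induction w)
  case Nil
  then show ?case using p_id[of "[]"] by simp
next
  case (Cons l w)
  then have w: "w \<in> carrier F4" and red: "reduced_word (l # w)" and l: "[l] \<in> carrier F4" "fst l < 4"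
    by (auto simp: free_carrier reduced_Cons)
  have pl: "act (p [l]) \<eta> = lact l \<eta>" for \<eta>
  proof (cases "fst l < 3")
    case True
    then show ?thesis using p_id[of "[l]"] by simp
  next
    case False
    interpret p: group_hom F4 F3 p
      using p_hom by unfold_locales
    have "inv\<^bsub>F4\<^esub> [(3, True)] = [(3, False)]" by (simp add: inv_letter_def)
    then have "p [(3, False)] = []" using p.hom_inv[of "[(3, True)]"] p_3 by simp
    moreover have "l = (3, True) \<or> l = (3, False)" using False l by (cases l) auto
    ultimately have "p [l] = []" using p_3 by auto
    then show ?thesis using False by (simp add: lact_def)
  qed
  have "p (l # w) = foldr lmult (p [l]) (p w)"
    using hom_mult[OF p_hom l(1) w] lmult_reduced[OF red] by simp
  then show ?case using pl Cons.IH[OF w] act_mult[OF assms(2)] by simp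
qed

text \<open>The cells of \<open>E\<close> lie in finitely many cosets and read boundedly many
  letters of the boundary points there. \<open>move_all\<close> provides one \<open>m\<close> in F4
  that brings all these points \<open>\<xi> f\<close> so close to \<open>\<xi>' f\<close> that the
  cells see no difference.\<close>

lemma orbit_Y:
  assumes y: "y \<in> Y" and y': "y' \<in> Y" and E: "finite E" "E \<subseteq> carrier G"
  shows "\<exists>g\<in>carrier G. \<forall>h\<in>E. shift_act G g y h = y' h"
proof -
  define I where "I = snd ` E"
  \<comment> \<open>\<open>Suc\<close> because the first letter of \<open>act w \<xi>\<close>
    depends on \<open>length w + 1\<close> letters of \<open>\<xi>\<close>; it also makes the target
    words nonempty. The inserted \<open>0\<close> covers empty \<open>E\<close>.\<close>
  define R where "R = Suc (Max (insert 0 ((\<lambda>((u, v), f). length (\<alpha> (inv\<^bsub>Finf\<^esub> f) u)) ` E)))"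
  define \<xi> where "\<xi> f = (\<lambda>n. ray y n (([], []), f))" for f
  define \<xi>' where "\<xi>' f = (\<lambda>n. ray y' n (([], []), f))" for f
  have I: "finite I" "I \<subseteq> carrier Finf" using E by (auto simp: I_def G_def semidirect_product_def)
  have c: "(([], []), f) \<in> carrier G" if "f \<in> carrier Finf" for f using that by (simp add: carrier_G)
  have bd: "\<xi> f \<in> bdry" "\<xi>' f \<in> bdry" if "f \<in> carrier Finf" for f
    using ray_bdry[OF y c[OF that]] ray_bdry[OF y' c[OF that]] by (simp_all add: \<xi>_def \<xi>'_def)
  define v where "v f = map (\<xi>' f) [0..<R]" for f
  interpret S: separated_retractions I "\<lambda>f w. p (\<alpha> (inv\<^bsub>Finf\<^esub> f) w)" "\<lambda>f. \<alpha> f [(3, True)]"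
    by (rule separated[OF I(2)])
  have v: "reduced_word (v f) \<and> fst ` set (v f) \<subseteq> {..<3} \<and> v f \<noteq> []" if "f \<in> I" for f
    using bd(2)[of f] that I(2)
    by (auto simp: v_def reduced_word_def successively_conv_nth bdry_def R_def simp del: upt_Suc)
  obtain m where m: "m \<in> carrier F4"
    "\<forall>f\<in>I. \<forall>n<length (v f). act (p (\<alpha> (inv\<^bsub>Finf\<^esub> f) m)) (\<xi> f) n = v f ! n"
    using S.move_all[of \<xi> v] I bd(1) v by blast
  have m': "act (\<alpha> (inv\<^bsub>Finf\<^esub> f) m) (\<xi> f) n = \<xi>' f n" if "f \<in> I" "n < R" for f n
  proof -
    have f: "f \<in> carrier Finf" using that I by auto
    have "\<alpha> (inv\<^bsub>Finf\<^esub> f) m \<in> carrier F4" using f m(1) by (intro \<alpha>_closed Finf.inv_closed)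
    from act_p[OF this bd(1)[OF f]] show ?thesis
      using m(2)[rule_format, OF that(1), of n] that(2) by (simp add: v_def)
  qed
  \<comment> \<open>The shift by the inverse of \<open>k\<close> reads \<open>y\<close> at
    \<open>k h\<close>; the inverse of \<open>m\<close> in front of \<open>u\<close> turns into
    \<open>m\<close> acting on the boundary point before \<open>u^-1\<close> does.\<close>
  define k where "k = iU (inv\<^bsub>F4\<^esub> m)"
  have im: "inv\<^bsub>F4\<^esub> m \<in> carrier F4" using m(1) by (rule F4.inv_closed)
  have k: "k \<in> carrier G" using im by (simp only: k_def iU_closed)
  have "shift_act G (inv\<^bsub>G\<^esub> k) y h = y' h" if h: "h \<in> E" for h
  proof -
    obtain u t f where h_eq: "h = ((u, t), f)" by (metis prod.exhaust)
    then have hc: "u \<in> carrier F4" "t \<in> carrier F2" "f \<in> carrier Finf" using h E by (auto simp: carrier_G)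
    have f: "f \<in> I" using h h_eq by (force simp: I_def)
    let ?i = "inv\<^bsub>Finf\<^esub> f"
    have i: "?i \<in> carrier Finf" using hc by (intro Finf.inv_closed)
    have c: "\<alpha> ?i u \<in> carrier F4" "\<alpha> ?i m \<in> carrier F4" "inv\<^bsub>F4\<^esub> \<alpha> ?i m \<in> carrier F4"
      using \<alpha>_closed[OF i] hc(1) m(1) by (simp_all only: F4.inv_closed)
    have "length (\<alpha> ?i u) \<le> Max (insert 0 ((\<lambda>((u, v), f). length (\<alpha> (inv\<^bsub>Finf\<^esub> f) u)) ` E))"
      using E(1) h h_eq by (intro Max_ge) force+
    then have len: "length (inv_word (\<alpha> ?i u)) < R" by (simp add: R_def)
    interpret a: group_hom F4 F4 "\<alpha> ?i"
      using \<alpha>_hom[OF i] by unfold_locales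
    have "k \<otimes>\<^bsub>G\<^esub> h = ((inv\<^bsub>F4\<^esub> m \<otimes>\<^bsub>F4\<^esub> u, t), f)"
      using hc by (simp add: k_def h_eq iU_def G_mult \<alpha>_one del: free_mult free_inv)
    moreover have "\<alpha> ?i (inv\<^bsub>F4\<^esub> m \<otimes>\<^bsub>F4\<^esub> u) = inv\<^bsub>F4\<^esub> \<alpha> ?i m \<otimes>\<^bsub>F4\<^esub> \<alpha> ?i u"
      using im m(1) hc(1) by (simp only: a.hom_mult a.hom_inv)
    moreover have "inv_word (inv\<^bsub>F4\<^esub> \<alpha> ?i m \<otimes>\<^bsub>F4\<^esub> \<alpha> ?i u) = foldr lmult (inv_word (\<alpha> ?i u)) (\<alpha> ?i m)"
    proof -
      have "inv_word (inv\<^bsub>F4\<^esub> \<alpha> ?i m \<otimes>\<^bsub>F4\<^esub> \<alpha> ?i u) = inv\<^bsub>F4\<^esub> (inv\<^bsub>F4\<^esub> \<alpha> ?i m \<otimes>\<^bsub>F4\<^esub> \<alpha> ?i u)"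
        using free_inv[OF F4.m_closed[OF c(3,1)]] by simp
      also have "\<dots> = inv\<^bsub>F4\<^esub> \<alpha> ?i u \<otimes>\<^bsub>F4\<^esub> \<alpha> ?i m"
        using c by (simp only: F4.inv_mult_group F4.inv_inv)
      finally show ?thesis using c(1) by simp
    qed
    ultimately have "y (k \<otimes>\<^bsub>G\<^esub> h) = enc (act (inv_word (\<alpha> ?i u)) (act (\<alpha> ?i m) (\<xi> f)) 0)"
      using Y_eq[OF y F4.m_closed[OF im hc(1)] hc(2,3)] act_mult[OF bd(1)[OF hc(3)]]
      by (simp add: \<xi>_def del: free_mult free_inv)
    also have "act (inv_word (\<alpha> ?i u)) (act (\<alpha> ?i m) (\<xi> f)) 0 = act (inv_word (\<alpha> ?i u)) (\<xi>' f) 0"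
      using len m'[OF f] by (intro act_cong[of 1]) auto
    also have "enc \<dots> = y' h" using Y_eq[OF y' hc] by (simp add: h_eq \<xi>'_def)
    finally show ?thesis using k h E(2) by (auto simp: shift_act_def)
  qed
  then show ?thesis using k by (intro bexI[of _ "inv\<^bsub>G\<^esub> k"] G.inv_closed) auto
qed

lemma minimal_Y: "minimal_subshift G B Y"
proof (rule minimal_subshiftI[OF subshift_Y _ orbit_Y])
  show "Y \<noteq> {}" using infinite_Y by auto
qed

section \<open>The covering subshift of finite type\<close>

type_synonym symbol = "(nat \<times> bool) \<times> (nat \<times> bool) \<times> nat"

definition A :: "nat set" where
  "A = (to_nat :: symbol \<Rightarrow> nat) ` ({l. fst l < 3} \<times> {l. fst l < 3} \<times> {..<3})"

definition symbol_of :: "nat \<Rightarrow> symbol" where "symbol_of = from_nat"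

abbreviation dir :: "nat \<Rightarrow> nat \<times> bool" where "dir n \<equiv> fst (symbol_of n)"
abbreviation tape :: "nat \<Rightarrow> nat \<times> bool" where "tape n \<equiv> fst (snd (symbol_of n))"
abbreviation mark :: "nat \<Rightarrow> nat" where "mark n \<equiv> snd (snd (symbol_of n))"

text \<open>
  Besides the direction, a symbol carries a tape letter and a mark. Marks are functions of the factor
  \<open>F2\<close>: a cell marked \<open>0\<close> starts a ray \<open>v, va, va\<^sup>2, \<dots>\<close> of cells marked \<open>1\<close>, and every cell \<open>v\<close> or its
  neighbour \<open>vb\<close> starts such a ray. Along these rays the tape holds the infinite word. The direction
  is constant along the ray and hence tells every cell whether the word has to be shifted.
\<close>

definition local_rule :: "(elt \<Rightarrow> nat) \<Rightarrow> bool" where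
  "local_rule x \<longleftrightarrow>
     (\<forall>l. fst l < 2 \<longrightarrow> dir (x (iV [l])) = dir (x \<one>\<^bsub>G\<^esub>)) \<and>
     (\<forall>l. fst l < 4 \<longrightarrow> mark (x (iU [l])) = mark (x \<one>\<^bsub>G\<^esub>)) \<and>
     (mark (x \<one>\<^bsub>G\<^esub>) \<noteq> 2 \<longrightarrow> mark (x (iV [(0, True)])) = 1) \<and>
     (mark (x \<one>\<^bsub>G\<^esub>) \<noteq> 0 \<longrightarrow> mark (x (iV [(1, True)])) = 0) \<and>
     (mark (x \<one>\<^bsub>G\<^esub>) = 0 \<longrightarrow> tape (x \<one>\<^bsub>G\<^esub>) = dir (x \<one>\<^bsub>G\<^esub>)) \<and>
     (\<forall>l. fst l = 3 \<longrightarrow> tape (x (iU [l])) = tape (x \<one>\<^bsub>G\<^esub>)) \<and>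
     (\<forall>s. fst s < 3 \<longrightarrow> mark (x \<one>\<^bsub>G\<^esub>) \<noteq> 2 \<longrightarrow> dir (x \<one>\<^bsub>G\<^esub>) = s \<longrightarrow>
       tape (x (iU [s])) = tape (x (iV [(0, True)]))) \<and>
     (\<forall>s. fst s < 3 \<longrightarrow> (dir (x (iU [s])) = inv_letter s \<longleftrightarrow> dir (x \<one>\<^bsub>G\<^esub>) \<noteq> s))"

definition X :: "(elt \<Rightarrow> nat) set" where
  "X = {x \<in> topspace (full_shift G A). \<forall>g\<in>carrier G. local_rule (\<lambda>s. x (g \<otimes>\<^bsub>G\<^esub> s))}"

lemma sft_X: "sft G A X"
  unfolding X_def
proof (rule sft_local[OF group_G])
  show "finite A"
    unfolding A_def by (intro finite_imageI finite_cartesian_product finite_letters finite_lessThan)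
  let ?W = "insert \<one>\<^bsub>G\<^esub> ((\<lambda>l. iU [l]) ` {l. fst l < 4} \<union> (\<lambda>l. iV [l]) ` {l. fst l < 2})"
  show "finite ?W" by (simp add: finite_letters)
  show "?W \<subseteq> carrier G" by auto
  fix x x' :: "elt \<Rightarrow> nat"
  assume eq: "\<And>s. s \<in> ?W \<Longrightarrow> x s = x' s"
  have "x \<one>\<^bsub>G\<^esub> = x' \<one>\<^bsub>G\<^esub>" by (rule eq) simp
  moreover have "x (iU [l]) = x' (iU [l])" if "fst l < 4" for l by (rule eq) (use that in auto)
  moreover have "x (iV [l]) = x' (iV [l])" if "fst l < 2" for l by (rule eq) (use that in auto)
  ultimately show "local_rule x \<longleftrightarrow> local_rule x'" unfolding local_rule_def by simp
qed

section \<open>The factor map from X into Y\<close>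

definition \<phi> :: "(elt \<Rightarrow> nat) \<Rightarrow> elt \<Rightarrow> nat" where
  "\<phi> x = (\<lambda>g\<in>carrier G. enc (dir (x g)))"

context
  fixes x assumes x: "x \<in> X"
begin

lemma X_rule:
  assumes "g \<in> carrier G"
  shows
    X_dir_V: "\<And>l. fst l < 2 \<Longrightarrow> dir (x (g \<otimes>\<^bsub>G\<^esub> iV [l])) = dir (x g)" and
    X_mark_U: "\<And>l. fst l < 4 \<Longrightarrow> mark (x (g \<otimes>\<^bsub>G\<^esub> iU [l])) = mark (x g)" and
    X_mark_ray: "mark (x g) \<noteq> 2 \<Longrightarrow> mark (x (g \<otimes>\<^bsub>G\<^esub> iV [(0, True)])) = 1" and
    X_mark_base: "mark (x g) \<noteq> 0 \<Longrightarrow> mark (x (g \<otimes>\<^bsub>G\<^esub> iV [(1, True)])) = 0" and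
    X_base: "mark (x g) = 0 \<Longrightarrow> tape (x g) = dir (x g)" and
    X_tape_3: "\<And>l. fst l = 3 \<Longrightarrow> tape (x (g \<otimes>\<^bsub>G\<^esub> iU [l])) = tape (x g)" and
    X_tape: "\<And>s. fst s < 3 \<Longrightarrow> mark (x g) \<noteq> 2 \<Longrightarrow> dir (x g) = s \<Longrightarrow>
       tape (x (g \<otimes>\<^bsub>G\<^esub> iU [s])) = tape (x (g \<otimes>\<^bsub>G\<^esub> iV [(0, True)]))" and
    X_dir: "\<And>s. fst s < 3 \<Longrightarrow> dir (x (g \<otimes>\<^bsub>G\<^esub> iU [s])) = inv_letter s \<longleftrightarrow> dir (x g) \<noteq> s"
proof -
  have "local_rule (\<lambda>s. x (g \<otimes>\<^bsub>G\<^esub> s))" using x assms by (simp add: X_def)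
  note r = this[unfolded local_rule_def G.r_one[OF assms]]
  show "\<And>l. fst l < 2 \<Longrightarrow> dir (x (g \<otimes>\<^bsub>G\<^esub> iV [l])) = dir (x g)"
    "\<And>l. fst l < 4 \<Longrightarrow> mark (x (g \<otimes>\<^bsub>G\<^esub> iU [l])) = mark (x g)"
    "mark (x g) \<noteq> 2 \<Longrightarrow> mark (x (g \<otimes>\<^bsub>G\<^esub> iV [(0, True)])) = 1"
    "mark (x g) \<noteq> 0 \<Longrightarrow> mark (x (g \<otimes>\<^bsub>G\<^esub> iV [(1, True)])) = 0"
    "mark (x g) = 0 \<Longrightarrow> tape (x g) = dir (x g)"
    "\<And>l. fst l = 3 \<Longrightarrow> tape (x (g \<otimes>\<^bsub>G\<^esub> iU [l])) = tape (x g)"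
    "\<And>s. fst s < 3 \<Longrightarrow> mark (x g) \<noteq> 2 \<Longrightarrow> dir (x g) = s \<Longrightarrow>
       tape (x (g \<otimes>\<^bsub>G\<^esub> iU [s])) = tape (x (g \<otimes>\<^bsub>G\<^esub> iV [(0, True)]))"
    "\<And>s. fst s < 3 \<Longrightarrow> dir (x (g \<otimes>\<^bsub>G\<^esub> iU [s])) = inv_letter s \<longleftrightarrow> dir (x g) \<noteq> s"
    using r by blast+
qed

lemma X_symbol: "g \<in> carrier G \<Longrightarrow> fst (dir (x g)) < 3"
proof -
  assume "g \<in> carrier G"
  then have "x g \<in> A" using x by (auto simp: X_def topspace_full_shift)
  then show ?thesis by (auto simp: A_def symbol_of_def)
qed

lemma X_dir_V_word: "g \<in> carrier G \<Longrightarrow> v \<in> carrier F2 \<Longrightarrow> dir (x (g \<otimes>\<^bsub>G\<^esub> iV v)) = dir (x g)"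
proof (induction v rule: rev_induct)
  case Nil
  then show ?case by (simp add: iV_Nil)
next
  case (snoc l v)
  then have v: "v \<in> carrier F2" "reduced_word (v @ [l])" "[l] \<in> carrier F2"
    by (auto simp: free_carrier reduced_append)
  have "iV v \<otimes>\<^bsub>G\<^esub> iV [l] = iV (v @ [l])"
    using iV_mult[OF v(1,3)] foldr_lmult_append[OF v(2)] by simp
  then have "(g \<otimes>\<^bsub>G\<^esub> iV v) \<otimes>\<^bsub>G\<^esub> iV [l] = g \<otimes>\<^bsub>G\<^esub> iV (v @ [l])"
    using v snoc.prems G.m_assoc[of g "iV v" "iV [l]"] by simp
  moreover have "g \<otimes>\<^bsub>G\<^esub> iV v \<in> carrier G" using snoc.prems v by (intro G.m_closed) simp_all
  ultimately show ?case using X_dir_V[of "g \<otimes>\<^bsub>G\<^esub> iV v" l] snoc v by simp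
qed

definition base :: "(elt) set" where
  "base = {k \<in> carrier G. mark (x k) = 0}"

abbreviation arm :: "nat \<Rightarrow> elt" where
  "arm n \<equiv> iV (replicate n (0, True))"

text \<open>The tape along the arm \<open>k, ka, ka^2, ...\<close>; on base cells it is the
  counterpart of \<open>ray\<close>.\<close>

definition stored :: "elt \<Rightarrow> nat \<Rightarrow> nat \<times> bool" where
  "stored k n = tape (x (k \<otimes>\<^bsub>G\<^esub> arm n))"

lemma arm_word: "replicate n (0, True) \<in> carrier F2"
proof -
  have "reduced_word (replicate n (0 :: nat, True))"
    by (induction n) (auto simp: reduced_Cons inv_letter_def)
  then show ?thesis by (auto simp: free_carrier)
qed

lemma arm_closed: "k \<in> carrier G \<Longrightarrow> k \<otimes>\<^bsub>G\<^esub> arm n \<in> carrier G"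
  using arm_word by (intro G.m_closed) simp_all

lemma arm_Suc: "k \<in> carrier G \<Longrightarrow> (k \<otimes>\<^bsub>G\<^esub> arm n) \<otimes>\<^bsub>G\<^esub> iV [(0, True)] = k \<otimes>\<^bsub>G\<^esub> arm (Suc n)"
proof -
  assume k: "k \<in> carrier G"
  have "replicate n (0, True) @ [(0, True)] = replicate (Suc n) (0 :: nat, True)"
    by (simp add: replicate_append_same)
  moreover have "reduced_word (replicate (Suc n) (0 :: nat, True))"
    using arm_word[of "Suc n"] by (simp add: free_carrier)
  ultimately have "foldr lmult (replicate n (0, True)) [(0 :: nat, True)] = replicate (Suc n) (0, True)"
    using foldr_lmult_append by metis
  then have "arm n \<otimes>\<^bsub>G\<^esub> iV [(0, True)] = arm (Suc n)"
    using iV_mult[OF arm_word[of n], of "[(0, True)]"] by simp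
  then show ?thesis using G.m_assoc[of k "arm n" "iV [(0, True)]"] k arm_word[of n] by simp
qed

text \<open>The mark rule propagates along the arm: behind the base cell all marks are
  \<open>1\<close>. So the tape rule, which exempts mark \<open>2\<close>, applies at every cell of
  the arm.\<close>

lemma arm_mark: "k \<in> base \<Longrightarrow> mark (x (k \<otimes>\<^bsub>G\<^esub> arm n)) \<noteq> 2"
proof (induction n)
  case 0
  then show ?case by (simp add: iV_Nil base_def)
next
  case (Suc n)
  then have k: "k \<in> carrier G" by (simp add: base_def)
  show ?case using X_mark_ray[OF arm_closed[OF k] Suc.IH[OF Suc.prems]] arm_Suc[OF k, of n] by simp
qed

lemma base_U: "k \<in> base \<Longrightarrow> fst l < 4 \<Longrightarrow> k \<otimes>\<^bsub>G\<^esub> iU [l] \<in> base"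
  using X_mark_U[of k l] by (auto simp: base_def intro!: G.m_closed)

lemma stored_0: "k \<in> base \<Longrightarrow> stored k 0 = dir (x k)"
  using X_base[of k] by (auto simp: base_def stored_def iV_Nil)

text \<open>F2 commutes with F4, so the arms at \<open>k\<close> and \<open>k s\<close> are
  parallel, and the tape rule at cell \<open>n\<close> of the former equates cell \<open>n\<close>
  of the latter with cell \<open>n + 1\<close> of the former. The direction \<open>s\<close> is the
  same along the whole arm.\<close>

lemma stored_Suc:
  assumes "k \<in> base" "fst s < 3" "dir (x k) = s"
  shows "stored (k \<otimes>\<^bsub>G\<^esub> iU [s]) n = stored k (Suc n)"
proof -
  have k: "k \<in> carrier G" using assms by (simp add: base_def)
  have "stored (k \<otimes>\<^bsub>G\<^esub> iU [s]) n = tape (x ((k \<otimes>\<^bsub>G\<^esub> arm n) \<otimes>\<^bsub>G\<^esub> iU [s]))"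
    using shift_swap[OF k _ arm_word, of "[s]"] assms(2) by (simp add: stored_def)
  also have "\<dots> = tape (x ((k \<otimes>\<^bsub>G\<^esub> arm n) \<otimes>\<^bsub>G\<^esub> iV [(0, True)]))"
    by (rule X_tape[OF arm_closed[OF k] assms(2) arm_mark[OF assms(1)]])
      (simp add: X_dir_V_word[OF k arm_word] assms(3))
  finally show ?thesis using arm_Suc[OF k] by (simp add: stored_def)
qed

text \<open>As in \<open>ray_step\<close>, except that for \<open>d\<close> a local rule now
  suffices, since the tape is copied cell by cell. In the last case \<open>stored_Suc\<close> is
  applied from the new cell back to \<open>k\<close>.\<close>

lemma stored_step:
  assumes k: "k \<in> base" and l: "fst l < 4"
  shows "stored (k \<otimes>\<^bsub>G\<^esub> iU [l]) = lact (inv_letter l) (stored k)"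
proof (cases "fst l = 3")
  case True
  have kG: "k \<in> carrier G" using k by (simp add: base_def)
  have "stored (k \<otimes>\<^bsub>G\<^esub> iU [l]) n = stored k n" for n
    using shift_swap[OF kG _ arm_word, of "[l]"] l X_tape_3[OF arm_closed[OF kG] True]
    by (simp add: stored_def)
  then show ?thesis using True by (auto simp: lact_def)
next
  case False
  then have l3: "fst l < 3" using l by simp
  show ?thesis
  proof (cases "dir (x k) = l")
    case True
    then show ?thesis
      using stored_Suc[OF k l3] stored_0[OF k] l3 by (auto simp: lact_def)
  next
    case False
    have kG: "k \<in> carrier G" using k by (simp add: base_def)
    let ?k = "k \<otimes>\<^bsub>G\<^esub> iU [l]"
    have k': "?k \<in> base" by (rule base_U[OF k l])
    have d: "dir (x ?k) = inv_letter l" using X_dir[OF kG l3] False by simp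
    have "?k \<otimes>\<^bsub>G\<^esub> iU [inv_letter l] = k"
      using shift_iU[of k "[l]" "[inv_letter l]"] kG l by (simp add: iU_Nil)
    then have "stored ?k (Suc n) = stored k n" for n
      using stored_Suc[OF k' _ d] l3 by simp
    then have "stored ?k n = case_nat (inv_letter l) (stored k) n" for n
      using stored_0[OF k'] d by (cases n) simp_all
    then show ?thesis using stored_0[OF k] False l3 by (auto simp: lact_def)
  qed
qed

lemma stored_act:
  "k \<in> base \<Longrightarrow> w \<in> carrier F4 \<Longrightarrow> k \<otimes>\<^bsub>G\<^esub> iU w \<in> base \<and> stored (k \<otimes>\<^bsub>G\<^esub> iU w) = act (inv_word w) (stored k)"
proof (rule act_along_word[of base stored])
  show "base \<subseteq> carrier G" by (auto simp: base_def)
qed (use base_U stored_step in auto)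

text \<open>The local rules imply the nonlocal clause of \<open>Y\<close>: from a base cell, the
  direction after \<open>w\<close> is the first letter of \<open>w^-1\<close> applied to the stored
  word, and a step by \<open>l\<close> leaves that word unchanged.\<close>

lemma X_kernel:
  assumes g: "g \<in> carrier G" and w: "w \<in> carrier F4" and l: "fst l = 3"
  shows "dir (x (g \<otimes>\<^bsub>G\<^esub> iU ([l] \<otimes>\<^bsub>F4\<^esub> w))) = dir (x (g \<otimes>\<^bsub>G\<^esub> iU w))"
proof -
  \<comment> \<open>By the mark rules \<open>g\<close> or its neighbour \<open>g b\<close> is a base
    cell, and directions do not change under steps in F2.\<close>
  obtain v where v: "v \<in> carrier F2" and k: "g \<otimes>\<^bsub>G\<^esub> iV v \<in> base"
  proof (cases "mark (x g) = 0")
    case True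
    then show ?thesis using that[of "[]"] g by (simp add: iV_Nil base_def)
  next
    case False
    then show ?thesis using that[of "[(1, True)]"] X_mark_base[OF g False] g
      by (simp add: base_def G.m_closed)
  qed
  define k where "k = g \<otimes>\<^bsub>G\<^esub> iV v"
  have kb: "k \<in> base" and kG: "k \<in> carrier G" using k by (simp_all add: k_def base_def)
  have lc: "[l] \<in> carrier F4" using l by simp
  have kl: "k \<otimes>\<^bsub>G\<^esub> iU [l] \<in> base" using base_U[OF kb] l by simp
  have dir_k: "dir (x (g \<otimes>\<^bsub>G\<^esub> iU u)) = dir (x (k \<otimes>\<^bsub>G\<^esub> iU u))" if "u \<in> carrier F4" for u
    using X_dir_V_word[OF _ v, of "g \<otimes>\<^bsub>G\<^esub> iU u"] shift_swap[OF g that v] that g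
    by (simp add: k_def G.m_closed)
  have "dir (x (g \<otimes>\<^bsub>G\<^esub> iU ([l] \<otimes>\<^bsub>F4\<^esub> w))) = dir (x ((k \<otimes>\<^bsub>G\<^esub> iU [l]) \<otimes>\<^bsub>G\<^esub> iU w))"
    using dir_k[OF F4.m_closed[OF lc w]] shift_iU[OF kG lc w] by simp
  also have "\<dots> = act (inv_word w) (stored (k \<otimes>\<^bsub>G\<^esub> iU [l])) 0"
    using stored_act[OF kl w] stored_0 by metis
  also have "\<dots> = act (inv_word w) (stored k) 0"
    using stored_step[OF kb, of l] l by (simp add: lact_def)
  also have "\<dots> = dir (x (g \<otimes>\<^bsub>G\<^esub> iU w))"
    using stored_act[OF kb w] stored_0 dir_k[OF w] by metis
  finally show ?thesis .
qed

lemma \<phi>_in_Y: "\<phi> x \<in> Y"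
proof -
  have "\<phi> x \<in> carrier G \<rightarrow>\<^sub>E B"
    using X_symbol by (auto simp: \<phi>_def B_def)
  moreover have "\<phi> x g = enc (dir (x g))" if "g \<in> carrier G" for g
    using that by (simp add: \<phi>_def)
  moreover have "g \<otimes>\<^bsub>G\<^esub> iU w \<in> carrier G" "g \<otimes>\<^bsub>G\<^esub> iU ([l] \<otimes>\<^bsub>F4\<^esub> w) \<in> carrier G"
    if "g \<in> carrier G" "w \<in> carrier F4" "fst l = 3" for g w l
    using that F4.m_closed[of "[l]" w] by (simp_all del: free_mult add: G.m_closed)
  moreover have "g \<otimes>\<^bsub>G\<^esub> iU [s] \<in> carrier G" if "g \<in> carrier G" "fst s < 3" for g s
    using that by (simp add: G.m_closed)
  moreover have "g \<otimes>\<^bsub>G\<^esub> iV v \<in> carrier G" if "g \<in> carrier G" "v \<in> carrier F2" for g v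
    using that by (simp add: G.m_closed)
  ultimately show ?thesis
    unfolding Y_def using X_dir_V_word X_dir X_kernel by (simp del: free_mult)
qed

end

section \<open>Lifting points of Y to X\<close>

text \<open>For words ending in \<open>a\<close>, the position on their arm; \<open>0\<close> at the
  start of an arm.\<close>

definition trail :: "nat word \<Rightarrow> nat" where
  "trail v = length (takeWhile (\<lambda>l. l = (0, True)) (rev v))"

text \<open>A concrete marking: arms start at the words not ending in \<open>a\<close> or
  \<open>a^-1\<close>, run through those ending in \<open>a\<close>, and avoid those ending in
  \<open>a^-1\<close>.\<close>

definition phase :: "nat word \<Rightarrow> nat" where
  "phase v = (if v = [] then 0 else if last v = (0, True) then 1 else if last v = (0, False) then 2 else 0)"

text \<open>The hypotheses on the phase exclude words ending in \<open>a^-1\<close> before a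
  multiplication by \<open>a\<close>, and words ending in \<open>b^-1\<close> before one by
  \<open>b\<close>, so the letter is simply appended.\<close>

lemma phase_trail:
  assumes v: "v \<in> carrier F2"
  shows "phase v < 3" "phase v = 0 \<Longrightarrow> trail v = 0"
    "phase v \<noteq> 2 \<Longrightarrow> phase (v \<otimes>\<^bsub>F2\<^esub> [(0, True)]) = 1 \<and> trail (v \<otimes>\<^bsub>F2\<^esub> [(0, True)]) = Suc (trail v)"
    "phase v \<noteq> 0 \<Longrightarrow> phase (v \<otimes>\<^bsub>F2\<^esub> [(1, True)]) = 0"
proof -
  show "phase v < 3" by (simp add: phase_def)
  show "phase v = 0 \<Longrightarrow> trail v = 0"
    by (cases v rule: rev_cases) (auto simp: phase_def trail_def split: if_splits)
  have app: "v \<otimes>\<^bsub>F2\<^esub> [l] = v @ [l]" if "v = [] \<or> last v \<noteq> inv_letter l" for l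
  proof -
    have "reduced_word (v @ [l])"
      using v that inv_letter_inv_letter[of "last v"] by (auto simp: free_carrier reduced_append)
    then show ?thesis using foldr_lmult_append by simp
  qed
  show "phase v \<noteq> 2 \<Longrightarrow> phase (v \<otimes>\<^bsub>F2\<^esub> [(0, True)]) = 1 \<and> trail (v \<otimes>\<^bsub>F2\<^esub> [(0, True)]) = Suc (trail v)"
    using app[of "(0, True)"] by (auto simp: phase_def trail_def inv_letter_def split: if_splits)
  show "phase v \<noteq> 0 \<Longrightarrow> phase (v \<otimes>\<^bsub>F2\<^esub> [(1, True)]) = 0"
    using app[of "(1, True)"] by (auto simp: phase_def inv_letter_def split: if_splits)
qed

text \<open>Cell number \<open>n\<close> of an arm holds letter number \<open>n\<close> of the ray.
  Rays do not change along F2, so the arm spells the ray of its base cell.\<close>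

definition lift :: "(elt \<Rightarrow> nat) \<Rightarrow> elt \<Rightarrow> nat" where
  "lift y = (\<lambda>g\<in>carrier G. to_nat (dec (y g), ray y (trail (snd (fst g))) g, phase (snd (fst g))))"

lemma ray_V:
  assumes y: "y \<in> Y" and v: "v \<in> carrier F2"
  shows "g \<in> carrier G \<Longrightarrow> ray y n (g \<otimes>\<^bsub>G\<^esub> iV v) = ray y n g"
proof (induction n arbitrary: g)
  case 0
  then show ?case using Y_V[OF y 0 v] by simp
next
  case (Suc n)
  have s: "[dec (y g)] \<in> carrier F4" using Y_letter[OF y Suc.prems] by simp
  show ?case
    using Suc.IH[OF next_closed[OF y Suc.prems]] Y_V[OF y Suc.prems v] shift_swap[OF Suc.prems s v]
    by simp
qed

lemma lift_in_X:
  assumes y: "y \<in> Y"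
  shows "lift y \<in> X" "\<phi> (lift y) = y"
proof -
  let ?v = "\<lambda>g :: elt. snd (fst g)"
  have vc: "?v g \<in> carrier F2" if "g \<in> carrier G" for g
    using that by (cases g) (auto simp: carrier_G)
  have lift_symbol: "dir (lift y g) = dec (y g)" "tape (lift y g) = ray y (trail (?v g)) g" "mark (lift y g) = phase (?v g)"
    if "g \<in> carrier G" for g
    using that by (simp_all add: lift_def symbol_of_def)
  have v_U: "?v (g \<otimes>\<^bsub>G\<^esub> iU w) = ?v g" if "g \<in> carrier G" "w \<in> carrier F4" for g w
    using that by (cases g) (auto simp: carrier_G mult_iU)
  have v_V: "?v (g \<otimes>\<^bsub>G\<^esub> iV t) = ?v g \<otimes>\<^bsub>F2\<^esub> t" if "g \<in> carrier G" "t \<in> carrier F2" for g t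
    using that by (cases g) (auto simp: carrier_G mult_iV)
  have "local_rule (\<lambda>s. lift y (g \<otimes>\<^bsub>G\<^esub> s))" if g: "g \<in> carrier G" for g
  proof -
    have U: "g \<otimes>\<^bsub>G\<^esub> iU [l] \<in> carrier G" "?v (g \<otimes>\<^bsub>G\<^esub> iU [l]) = ?v g" if "fst l < 4" for l
      using that g v_U[OF g, of "[l]"] by (simp_all add: G.m_closed)
    have V: "g \<otimes>\<^bsub>G\<^esub> iV [l] \<in> carrier G" "?v (g \<otimes>\<^bsub>G\<^esub> iV [l]) = ?v g \<otimes>\<^bsub>F2\<^esub> [l]"
      "y (g \<otimes>\<^bsub>G\<^esub> iV [l]) = y g" "\<And>n. ray y n (g \<otimes>\<^bsub>G\<^esub> iV [l]) = ray y n g" if "fst l < 2" for l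
      using that g v_V[OF g, of "[l]"] Y_V[OF y g, of "[l]"] ray_V[OF y _ g, of "[l]"]
      by (simp_all add: G.m_closed del: free_mult)
    note pt = phase_trail[OF vc[OF g]]
    show ?thesis
      unfolding local_rule_def G.r_one[OF g]
    proof (intro conjI allI impI)
      fix l :: "nat \<times> bool" assume "fst l < 2"
      then show "dir (lift y (g \<otimes>\<^bsub>G\<^esub> iV [l])) = dir (lift y g)"
        using lift_symbol(1) V g by simp
    next
      fix l :: "nat \<times> bool" assume "fst l < 4"
      then show "mark (lift y (g \<otimes>\<^bsub>G\<^esub> iU [l])) = mark (lift y g)"
        using lift_symbol(3) U g by simp
    next
      assume "mark (lift y g) \<noteq> 2"
      then show "mark (lift y (g \<otimes>\<^bsub>G\<^esub> iV [(0, True)])) = 1"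
        using lift_symbol(3)[OF V(1)[of "(0, True)"]] V(2)[of "(0, True)"] pt(3) lift_symbol(3)[OF g]
        by (simp del: free_mult)
    next
      assume "mark (lift y g) \<noteq> 0"
      then show "mark (lift y (g \<otimes>\<^bsub>G\<^esub> iV [(1, True)])) = 0"
        using lift_symbol(3)[OF V(1)[of "(1, True)"]] V(2)[of "(1, True)"] pt(4) lift_symbol(3)[OF g]
        by (simp del: free_mult)
    next
      assume "mark (lift y g) = 0"
      then show "tape (lift y g) = dir (lift y g)" using lift_symbol[OF g] pt(2) by simp
    next
      fix l :: "nat \<times> bool" assume "fst l = 3"
      then show "tape (lift y (g \<otimes>\<^bsub>G\<^esub> iU [l])) = tape (lift y g)"
        using lift_symbol(2)[OF g] lift_symbol(2)[OF U(1)[of l]] U(2)[of l] ray_kernel[OF y _ g, of l] by simp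
    next
      fix s :: "nat \<times> bool" assume s: "fst s < 3" "mark (lift y g) \<noteq> 2" "dir (lift y g) = s"
      \<comment> \<open>The cell \<open>g s\<close> has the same \<open>trail\<close> and the ray of
        \<open>g\<close> without its first letter; \<open>g a\<close> has the ray of
        \<open>g\<close> and a \<open>trail\<close> larger by one. Both therefore hold the same
        letter.\<close>
      have "tape (lift y (g \<otimes>\<^bsub>G\<^esub> iU [s])) = ray y (trail (?v g)) (g \<otimes>\<^bsub>G\<^esub> iU [s])"
        using lift_symbol(2)[OF U(1)[of s]] U(2)[of s] s(1) by simp
      also have "\<dots> = ray y (Suc (trail (?v g))) g" using s(3) lift_symbol(1)[OF g] by simp
      also have "\<dots> = tape (lift y (g \<otimes>\<^bsub>G\<^esub> iV [(0, True)]))"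
        using lift_symbol(2)[OF V(1)[of "(0, True)"]] V(2,4)[of "(0, True)"] pt(3) s(2) lift_symbol(3)[OF g]
        by (simp del: free_mult ray.simps)
      finally show "tape (lift y (g \<otimes>\<^bsub>G\<^esub> iU [s])) = tape (lift y (g \<otimes>\<^bsub>G\<^esub> iV [(0, True)]))" .
    next
      fix s :: "nat \<times> bool" assume "fst s < 3"
      then show "dir (lift y (g \<otimes>\<^bsub>G\<^esub> iU [s])) = inv_letter s \<longleftrightarrow> dir (lift y g) \<noteq> s"
        using lift_symbol(1) U(1)[of s] g Y_step[OF y g] by simp
    qed
  qed
  moreover have "lift y g \<in> A" if "g \<in> carrier G" for g
  proof -
    have "fst (ray y n g) < 3" for n using ray_bdry[OF y that] by (simp add: bdry_def)
    then show ?thesis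
      using that Y_letter[OF y that] phase_trail(1)[OF vc[OF that]] by (auto simp: lift_def A_def)
  qed
  ultimately show "lift y \<in> X"
    by (auto simp: X_def topspace_full_shift lift_def)
  have "y \<in> carrier G \<rightarrow>\<^sub>E B" using y by (simp add: Y_def)
  then show "\<phi> (lift y) = y"
    using dec_B(2) lift_symbol(1) by (auto simp: \<phi>_def fun_eq_iff PiE_iff extensional_def)
qed

lemma sofic_Y: "sofic_shift G B Y"
  unfolding sofic_shift_def
proof (intro conjI subshift_Y exI[of _ A] exI[of _ X] exI[of _ \<phi>] sft_X ballI)
  have "continuous_map (full_shift G A) (full_shift G B) \<phi>"
    unfolding \<phi>_def[abs_def] by (rule continuous_map_recoding) (auto simp: A_def B_def symbol_of_def)
  then show "continuous_map (subtopology (full_shift G A) X) (subtopology (full_shift G B) Y) \<phi>"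
    using \<phi>_in_Y by (auto simp: continuous_map_in_subtopology continuous_map_from_subtopology)
  show "\<phi> (shift_act G g x) = shift_act G g (\<phi> x)" if "g \<in> carrier G" for g x
    using that by (auto simp: \<phi>_def shift_act_def fun_eq_iff)
  show "\<phi> ` X = Y"
    using \<phi>_in_Y lift_in_X by (auto simp: image_iff) metis
qed

end

theorem theorem1:
  shows "\<exists>\<theta> \<in> hom (free_group (UNIV :: nat set))
                    (AutoGroup (free_group {..<4 :: nat} \<times>\<times> free_group {..<2 :: nat})).
           \<exists>G. G = semidirect_product (free_group {..<4 :: nat} \<times>\<times> free_group {..<2 :: nat})
                     (free_group (UNIV :: nat set)) \<theta> \<and>
               (\<exists>(B :: nat set) Y.
                  finite B \<and> sofic_shift G B Y \<and> infinite Y \<and> minimal_subshift G B Y)"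
proof -
  obtain p \<alpha> where "twisted p \<alpha>"
    by (rule twisting_automorphisms, rule that, unfold_locales) blast+
  then interpret twisted p \<alpha> .
  show ?thesis
    using \<theta>_hom finite_B sofic_Y infinite_Y minimal_Y unfolding G_def by blast
qed

end
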